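(* Let $u=\alpha v_i$, $\alpha\in K[H]$, $i\in\mathbb{Z}$, be a homogeneous non-scalar element of $A_1$. Then $u\in\Delta_1\cup\Delta_2\cup\Delta_3\cup\Delta_5$. In more detail: 1. $u\in\Delta_1$ if and only if $\alpha\in K^*$ and $i\neq 0$. 2. $u\in\Delta_2$ if and only if $\alpha\notin K$ and $i\neq 0$. 3. $u\in\Delta_3$ if and only if $\deg_H\alpha=1$ and $i=0$. 4. $u\in\Delta_5$ if and only if $\deg_H\alpha>1$ and $i=0$.
   Context: $K$ is a field of characteristic zero, $K^*=K\setminus\{0\}$. $A_1$ is the first Weyl algebra over $K$, generated by $X,Y$ with $YX-XY=1$, and $H=YX$. Put $v_n=X^n$ for $n>0$, $v_n=Y^{-n}$ for $n<0$, $v_0=1$; then $A_1=\bigoplus_{i\in\mathbb{Z}}K[H]v_i$ is $\mathbb{Z}$-graded. For non-scalar $x\in A_1$, $\mathrm{ad}\,x(a)=xa-ax$, $C(x)=\ker\mathrm{ad}\,x$ is the centralizer of $x$, and $N(x)=\bigcup_{i\geq 0}\ker(\mathrm{ad}\,x)^{i+1}$. Let $\bar K$ be an algebraic closure of $K$ and $\bar A_1=\bar K\otimes_KA_1\supseteq A_1$ the Weyl algebra over $\bar K$. Let $D(x,\bar A_1)^{ev}=\bigoplus_{\lambda}D(x,\lambda,\bar A_1)$ be the direct sum, over all eigenvalues $\lambda\in\bar K$ of $\mathrm{ad}\,x$ on $\bar A_1$, of the eigenspaces $D(x,\lambda,\bar A_1)=\{a\in\bar A_1: xa-ax=\lambda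 a\}$. Put $D(x)=A_1\cap D(x,\bar A_1)^{ev}$. Dixmier's classes, which partition the set $A_1\setminus K$ of non-scalar elements, are: $\Delta_1=\{x\in A_1\setminus K: N(x)=A_1,\ D(x)=C(x)\}$; $\Delta_2=\{x\in A_1\setminus K: N(x)\neq A_1,\ N(x)\neq C(x),\ D(x)=C(x)\}$; $\Delta_3=\{x\in A_1\setminus K: D(x)=A_1,\ N(x)=C(x)\}$; $\Delta_4=\{x\in A_1\setminus K: D(x)\neq A_1,\ D(x)\neq C(x),\ N(x)=C(x)\}$; $\Delta_5=\{x\in A_1\setminus K: D(x)=N(x)=C(x)\}$. *)

theory Defs
  imports
    "HOL-Library.Poly_Mapping"
    "HOL-Algebra.Algebraic_Closure_Type"
begin

section \<open>The free algebra on two generators\<close>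

datatype weyl_gen = GX | GY

text \<open>
  Words form the free monoid. The monoid operation is written additively because the
  convolution product of \<^typ>\<open>'a \<Rightarrow>\<^sub>0 'b\<close> expects an additive monoid of exponents; it is of course
  not commutative. Thus \<open>word \<Rightarrow>\<^sub>0 'k\<close> is the free associative unital algebra on \<open>GX\<close>, \<open>GY\<close>.
\<close>

datatype word = Word (letters: "weyl_gen list")

instantiation word :: monoid_add
begin

definition zero_word :: word where "0 = Word []"
definition plus_word :: "word \<Rightarrow> word \<Rightarrow> word" where "v + w = Word (letters v @ letters w)"

instance by standard (auto simp: zero_word_def plus_word_def)

end

type_synonym 'k free_alg = "word \<Rightarrow>\<^sub>0 'k"

definition free_gen :: "weyl_gen \<Rightarrow> 'k::field free_alg" where
  "free_gen g = Poly_Mapping.single (Word [g]) 1"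

definition free_scalar :: "'k \<Rightarrow> 'k::field free_alg" where
  "free_scalar c = Poly_Mapping.single 0 c"

definition weyl_relator :: "'k::field free_alg" where
  "weyl_relator = free_gen GY * free_gen GX - free_gen GX * free_gen GY - 1"

text \<open>
  The two-sided ideal generated by the relator. Closure under negatives and scalars is
  automatic, since \<open>a\<close> ranges over all elements of the free algebra.
\<close>

inductive_set weyl_ideal :: "'k::field free_alg set" where
  zero: "0 \<in> weyl_ideal"
| gen: "a * weyl_relator * b \<in> weyl_ideal"
| add: "p \<in> weyl_ideal \<Longrightarrow> q \<in> weyl_ideal \<Longrightarrow> p + q \<in> weyl_ideal"

lemma weyl_ideal_mult_left: "p \<in> weyl_ideal \<Longrightarrow> c * p \<in> weyl_ideal"
proof (induction rule: weyl_ideal.induct)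
  case (gen a b)
  show ?case using weyl_ideal.gen[of "c * a" b] by (simp add: mult.assoc)
qed (auto simp: distrib_left intro: weyl_ideal.intros)

lemma weyl_ideal_mult_right: "p \<in> weyl_ideal \<Longrightarrow> p * c \<in> weyl_ideal"
proof (induction rule: weyl_ideal.induct)
  case (gen a b)
  show ?case using weyl_ideal.gen[of a "b * c"] by (simp add: mult.assoc)
qed (auto simp: distrib_right intro: weyl_ideal.intros)

lemma weyl_ideal_uminus: "p \<in> weyl_ideal \<Longrightarrow> - p \<in> weyl_ideal"
  using weyl_ideal_mult_left[of p "-1"] by simp

lemma weyl_ideal_diff: "p \<in> weyl_ideal \<Longrightarrow> q \<in> weyl_ideal \<Longrightarrow> p - q \<in> weyl_ideal"
  using weyl_ideal.add[of p "- q"] weyl_ideal_uminus[of q] by simp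

lemma free_alg_induct [case_names single add]:
  fixes f :: "'k::field free_alg"
  assumes single: "\<And>w c. P (Poly_Mapping.single w c)"
    and add: "\<And>f g. P f \<Longrightarrow> P g \<Longrightarrow> P (f + g)"
  shows "P f"
proof (induction f rule: update_induct)
  case const
  show ?case using single[of 0 0] by simp
next
  case (update f w c)
  have "Poly_Mapping.update w c f = f + Poly_Mapping.single w c"
    using update by (intro poly_mapping_eqI)
      (auto simp: lookup_update lookup_add lookup_single when_def in_keys_iff)
  thus ?case using update add single by metis
qed

text \<open>
  The free algebra acts on \<open>'k[t]\<close>, with \<open>GX\<close> acting by multiplication by \<open>t\<close> and \<open>GY\<close> by
  differentiation. This is used below only to see that the ideal is proper.
\<close>

fun gen_act :: "weyl_gen \<Rightarrow> 'k::field poly \<Rightarrow> 'k poly" where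
  "gen_act GX p = pCons 0 p"
| "gen_act GY p = pderiv p"

definition word_act :: "word \<Rightarrow> 'k::field poly \<Rightarrow> 'k poly" where
  "word_act w = foldr gen_act (letters w)"

definition free_act :: "'k::field free_alg \<Rightarrow> 'k poly \<Rightarrow> 'k poly" where
  "free_act f p = (\<Sum>w\<in>Poly_Mapping.keys f. smult (Poly_Mapping.lookup f w) (word_act w p))"

lemma gen_act_add: "gen_act g (p + q) = gen_act g p + gen_act g q"
  by (cases g) (auto simp: pderiv_add)

lemma gen_act_smult: "gen_act g (smult c p) = smult c (gen_act g p)"
  by (cases g) (auto simp: pderiv_smult)

lemma word_act_add: "word_act w (p + q) = word_act w p + word_act w q"
proof -
  have "foldr gen_act xs (p + q) = foldr gen_act xs p + foldr gen_act xs q" for xs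
    by (induction xs) (auto simp: gen_act_add)
  thus ?thesis by (simp add: word_act_def)
qed

lemma word_act_smult: "word_act w (smult c p) = smult c (word_act w p)"
proof -
  have "foldr gen_act xs (smult c p) = smult c (foldr gen_act xs p)" for xs
    by (induction xs) (auto simp: gen_act_smult)
  thus ?thesis by (simp add: word_act_def)
qed

lemma letters_zero: "letters 0 = []"
  by (simp add: zero_word_def)

lemma word_act_plus: "word_act (v + w) p = word_act v (word_act w p)"
  by (simp add: word_act_def plus_word_def)

lemma free_act_superset:
  assumes "finite A" "Poly_Mapping.keys f \<subseteq> A"
  shows "free_act f p = (\<Sum>w\<in>A. smult (Poly_Mapping.lookup f w) (word_act w p))"
  unfolding free_act_def using assms
  by (intro sum.mono_neutral_left) (auto simp: in_keys_iff)

lemma free_act_single: "free_act (Poly_Mapping.single w c) p = smult c (word_act w p)"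
  by (subst free_act_superset[of "{w}"]) auto

lemma free_act_plus: "free_act (f + g) p = free_act f p + free_act g p"
proof -
  let ?A = "Poly_Mapping.keys f \<union> Poly_Mapping.keys g"
  have *: "free_act h p = (\<Sum>w\<in>?A. smult (Poly_Mapping.lookup h w) (word_act w p))"
    if "Poly_Mapping.keys h \<subseteq> ?A" for h
    using that by (intro free_act_superset) auto
  show ?thesis
    by (subst (1 2 3) *) (use keys_add[of f g] in \<open>auto simp: lookup_add smult_add_left sum.distrib\<close>)
qed

lemma free_act_add_right: "free_act f (p + q) = free_act f p + free_act f q"
  by (simp add: free_act_def word_act_add smult_add_right sum.distrib)

lemma free_act_0 [simp]: "free_act 0 p = 0"
  by (simp add: free_act_def)

lemma free_act_1 [simp]: "free_act 1 p = p"
  using free_act_single[of 0 1 p]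
  by (simp add: word_act_def letters_zero)

lemma free_act_minus: "free_act (f - g) p = free_act f p - free_act g p"
  using free_act_plus[of "f - g" g p] by simp

lemma free_act_mult: "free_act (f * g) p = free_act f (free_act g p)"
proof (induction f rule: free_alg_induct)
  case (single v c)
  show ?case
  proof (induction g rule: free_alg_induct)
    case (single w d)
    show ?case
      by (simp add: mult_single free_act_single word_act_plus word_act_smult mult.commute)
  next
    case (add g h)
    thus ?case by (simp add: distrib_left free_act_plus free_act_add_right)
  qed
next
  case (add f h)
  thus ?case by (simp add: distrib_right free_act_plus)
qed

lemma free_act_ideal:
  assumes "f \<in> weyl_ideal"
  shows "free_act f p = 0"
  using assms
proof (induction arbitrary: p rule: weyl_ideal.induct)
  case (gen a b)
  have "free_act (free_gen GY * free_gen GX) q - free_act (free_gen GX * free_gen GY) q - q = 0"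
    for q :: "'a poly"
    by (simp add: free_act_mult free_gen_def free_act_single word_act_def pderiv_pCons)
  hence "free_act weyl_relator q = 0" for q :: "'a poly"
    by (simp add: weyl_relator_def free_act_minus)
  moreover have "free_act a 0 = 0"
    using free_act_add_right[of a 0 0] by (metis add.right_neutral add_left_imp_eq)
  ultimately show ?case by (simp add: free_act_mult)
qed (auto simp: free_act_plus)

lemma one_notin_weyl_ideal: "(1 :: 'k::field free_alg) \<notin> weyl_ideal"
proof
  assume "(1 :: 'k free_alg) \<in> weyl_ideal"
  from free_act_ideal[OF this, of 1] show False by simp
qed


section \<open>The first Weyl algebra\<close>

definition weyl_rel :: "'k::field free_alg \<Rightarrow> 'k free_alg \<Rightarrow> bool" where
  "weyl_rel p q \<longleftrightarrow> p - q \<in> weyl_ideal"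

lemma equivp_weyl_rel: "equivp weyl_rel"
proof (rule equivpI)
  show "reflp weyl_rel" by (auto simp: reflp_def weyl_rel_def intro: weyl_ideal.zero)
  show "symp weyl_rel"
    unfolding symp_def weyl_rel_def by (metis minus_diff_eq weyl_ideal_uminus)
  show "transp weyl_rel"
    unfolding transp_def weyl_rel_def by (metis diff_add_cancel add_diff_eq weyl_ideal.add)
qed

quotient_type (overloaded) 'k weyl = "'k::field free_alg" / weyl_rel
  by (rule equivp_weyl_rel)

instantiation weyl :: (field) ring_1
begin

lift_definition zero_weyl :: "'a weyl" is 0 .
lift_definition one_weyl :: "'a weyl" is 1 .
lift_definition plus_weyl :: "'a weyl \<Rightarrow> 'a weyl \<Rightarrow> 'a weyl" is "(+)"
  unfolding weyl_rel_def by (metis add_diff_add weyl_ideal.add)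
lift_definition minus_weyl :: "'a weyl \<Rightarrow> 'a weyl \<Rightarrow> 'a weyl" is "(-)"
proof -
  fix a b c d :: "'a free_alg"
  assume "weyl_rel a b" "weyl_rel c d"
  moreover have "(a - c) - (b - d) = (a - b) - (c - d)" by simp
  ultimately show "weyl_rel (a - c) (b - d)"
    unfolding weyl_rel_def by (metis weyl_ideal_diff)
qed
lift_definition uminus_weyl :: "'a weyl \<Rightarrow> 'a weyl" is uminus
  unfolding weyl_rel_def by (metis minus_diff_minus weyl_ideal_uminus)
lift_definition times_weyl :: "'a weyl \<Rightarrow> 'a weyl \<Rightarrow> 'a weyl" is "(*)"
proof -
  fix a b c d :: "'a free_alg"
  assume "weyl_rel a b" "weyl_rel c d"
  moreover have "a * c - b * d = (a - b) * c + b * (c - d)" by (simp add: algebra_simps)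
  ultimately show "weyl_rel (a * c) (b * d)"
    unfolding weyl_rel_def
    by (metis weyl_ideal.add weyl_ideal_mult_left weyl_ideal_mult_right)
qed

instance
proof
  show "(0 :: 'a weyl) \<noteq> 1"
  proof (transfer, rule notI)
    assume "weyl_rel (0 :: 'a free_alg) 1"
    hence "(- 1 :: 'a free_alg) \<in> weyl_ideal" by (simp add: weyl_rel_def)
    from weyl_ideal_uminus[OF this] show False by (simp add: one_notin_weyl_ideal)
  qed
qed (transfer; simp add: algebra_simps weyl_rel_def weyl_ideal.zero)+

end

lift_definition weyl_scalar :: "'k \<Rightarrow> 'k::field weyl" is free_scalar .
lift_definition weyl_X :: "'k::field weyl" is "free_gen GX" .
lift_definition weyl_Y :: "'k::field weyl" is "free_gen GY" .

lemma weyl_commutation: "weyl_Y * weyl_X - weyl_X * weyl_Y = 1"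
proof transfer
  show "weyl_rel (free_gen GY * free_gen GX - free_gen GX * free_gen GY) (1 :: 'a free_alg)"
    unfolding weyl_rel_def using weyl_ideal.gen[of 1 1] by (simp add: weyl_relator_def)
qed

definition weyl_H :: "'k::field weyl" where
  "weyl_H = weyl_Y * weyl_X"

definition weyl_v :: "int \<Rightarrow> 'k::field weyl" where
  "weyl_v n = (if n \<ge> 0 then weyl_X ^ nat n else weyl_Y ^ nat (- n))"

text \<open>
  The inclusion of \<open>K[H]\<close> into the algebra; elements of \<open>K[H]\<close> are given as abstract
  polynomials, so that their degree in \<open>H\<close> is \<^const>\<open>Polynomial.degree\<close>.
\<close>

definition weyl_polyH :: "'k::field poly \<Rightarrow> 'k weyl" where
  "weyl_polyH \<alpha> = (\<Sum>n\<le>Polynomial.degree \<alpha>. weyl_scalar (Polynomial.coeff \<alpha> n) * weyl_H ^ n)"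


section \<open>Extension of scalars to the algebraic closure\<close>

lemma lookup_map_to_ac [simp]:
  "Poly_Mapping.lookup (Poly_Mapping.map to_ac f) w = to_ac (Poly_Mapping.lookup f w)"
  by (simp add: map.rep_eq when_def)

lemma map_to_ac_add:
  "Poly_Mapping.map to_ac (f + g) = Poly_Mapping.map to_ac f + Poly_Mapping.map to_ac g"
  by (intro poly_mapping_eqI) (simp add: lookup_add)

lemma map_to_ac_diff:
  "Poly_Mapping.map to_ac (f - g) = Poly_Mapping.map to_ac f - Poly_Mapping.map to_ac g"
  by (intro poly_mapping_eqI) (simp add: lookup_minus)

lemma map_to_ac_mult:
  fixes f g :: "'k::field free_alg"
  shows "Poly_Mapping.map to_ac (f * g) = Poly_Mapping.map to_ac f * Poly_Mapping.map to_ac g"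
proof (induction f rule: free_alg_induct)
  case (single v c)
  show ?case
  proof (induction g rule: free_alg_induct)
    case (single w d)
    show ?case by (simp add: mult_single)
  next
    case (add g h)
    thus ?case by (simp add: distrib_left map_to_ac_add)
  qed
next
  case (add f h)
  thus ?case by (simp add: distrib_right map_to_ac_add)
qed

lemma map_to_ac_relator: "Poly_Mapping.map to_ac weyl_relator = weyl_relator"
proof -
  have 1: "Poly_Mapping.map to_ac (1 :: 'a free_alg) = 1"
    by (intro poly_mapping_eqI) (simp add: lookup_one when_def)
  have 2: "Poly_Mapping.map to_ac (free_gen g :: 'a free_alg) = free_gen g" for g
    by (simp add: free_gen_def)
  show ?thesis unfolding weyl_relator_def map_to_ac_diff map_to_ac_mult 1 2 ..
qed

lemma map_to_ac_ideal: "f \<in> weyl_ideal \<Longrightarrow> Poly_Mapping.map to_ac f \<in> weyl_ideal"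
proof (induction rule: weyl_ideal.induct)
  case zero
  have "Poly_Mapping.map to_ac (0 :: 'a free_alg) = 0"
    by (intro poly_mapping_eqI) simp
  thus ?case by (simp add: weyl_ideal.zero)
qed (auto simp: map_to_ac_add map_to_ac_mult map_to_ac_relator intro: weyl_ideal.intros)

text \<open>The canonical map \<open>a \<mapsto> 1 \<otimes> a\<close> from the Weyl algebra over \<open>K\<close> to that over its closure.\<close>

lift_definition weyl_ext :: "'k::field weyl \<Rightarrow> 'k alg_closure weyl"
  is "Poly_Mapping.map to_ac"
  unfolding weyl_rel_def by (metis map_to_ac_diff map_to_ac_ideal)


section \<open>Dixmier's classes\<close>

definition weyl_ad :: "'k::field weyl \<Rightarrow> 'k weyl \<Rightarrow> 'k weyl" where
  "weyl_ad x a = x * a - a * x"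

definition weyl_C :: "'k::field weyl \<Rightarrow> 'k weyl set" where
  "weyl_C x = {a. weyl_ad x a = 0}"

definition weyl_N :: "'k::field weyl \<Rightarrow> 'k weyl set" where
  "weyl_N x = (\<Union>i::nat. {a. (weyl_ad x ^^ (i + 1)) a = 0})"

definition weyl_eigenspace :: "'k::field weyl \<Rightarrow> 'k \<Rightarrow> 'k weyl set" where
  "weyl_eigenspace x \<mu> = {a. weyl_ad x a = weyl_scalar \<mu> * a}"

definition weyl_eigenvalues :: "'k::field weyl \<Rightarrow> 'k set" where
  "weyl_eigenvalues x = {\<mu>. \<exists>a. a \<noteq> 0 \<and> a \<in> weyl_eigenspace x \<mu>}"

text \<open>The sum of all eigenspaces, i.e. the set of finite sums of eigenvectors.\<close>

definition weyl_D_ev :: "'k::field weyl \<Rightarrow> 'k weyl set" where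
  "weyl_D_ev x = {\<Sum>\<mu>\<in>L. f \<mu> | L f. finite L \<and> L \<subseteq> weyl_eigenvalues x \<and>
     (\<forall>\<mu>\<in>L. f \<mu> \<in> weyl_eigenspace x \<mu>)}"

definition weyl_D :: "'k::field weyl \<Rightarrow> 'k weyl set" where
  "weyl_D x = {a. weyl_ext a \<in> weyl_D_ev (weyl_ext x)}"

definition weyl_nonscalars :: "'k::field weyl set" where
  "weyl_nonscalars = UNIV - range weyl_scalar"

definition Delta1 :: "'k::field weyl set" where
  "Delta1 = {x \<in> weyl_nonscalars. weyl_N x = UNIV \<and> weyl_D x = weyl_C x}"

definition Delta2 :: "'k::field weyl set" where
  "Delta2 = {x \<in> weyl_nonscalars. weyl_N x \<noteq> UNIV \<and> weyl_N x \<noteq> weyl_C x \<and> weyl_D x = weyl_C x}"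

definition Delta3 :: "'k::field weyl set" where
  "Delta3 = {x \<in> weyl_nonscalars. weyl_D x = UNIV \<and> weyl_N x = weyl_C x}"

definition Delta4 :: "'k::field weyl set" where
  "Delta4 = {x \<in> weyl_nonscalars. weyl_D x \<noteq> UNIV \<and> weyl_D x \<noteq> weyl_C x \<and> weyl_N x = weyl_C x}"

definition Delta5 :: "'k::field weyl set" where
  "Delta5 = {x \<in> weyl_nonscalars. weyl_D x = weyl_N x \<and> weyl_N x = weyl_C x}"

end

theory Submission
  imports Defs
begin

text \<open>
  Since \<open>v\<^sub>j p(H) = p(H - j) v\<^sub>j\<close>, everything is a computation with polynomials in the grading
  \<open>A\<^sub>1 = \<Oplus> K[H] v\<^sub>j\<close>.  For \<open>u = \<alpha>(H)\<close> the map \<open>ad u\<close> multiplies the component of degree \<open>j\<close> by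
  \<open>\<alpha>(H) - \<alpha>(H - j)\<close>, whose degree is \<open>deg \<alpha> - 1\<close> when \<open>j \<noteq> 0\<close>: there is no nilpotency
  beyond the centralizer, and nonzero eigenvalues occur only if \<open>deg \<alpha> = 1\<close>.
  For \<open>u = \<alpha> v\<^sub>i\<close> with \<open>i \<noteq> 0\<close>, \<open>ad u\<close> moves the degree by \<open>i\<close>, so by finiteness of the support
  it has no nonzero eigenvalue; \<open>[u, H] = - i u\<close> puts \<open>H\<close> into \<open>N(u)\<close> but not into \<open>C(u)\<close>.
  If \<open>\<alpha>\<close> is a constant, then \<open>X\<close> and \<open>Y\<close> lie in \<open>N(u)\<close>, which is a subalgebra.  If
  \<open>deg \<alpha> = d + 1 > 0\<close>, then \<open>(ad u)\<^sup>n v\<^sub>i = q\<^sub>n(H) v\<^sub>i\<^sup>n\<^sup>+\<^sup>1\<close> where \<open>q\<^sub>n\<close> has degree \<open>n d\<close> and is nonzero.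
\<close>

section \<open>Polynomials in \<open>H\<close>\<close>

lemma weyl_scalar_0 [simp]: "weyl_scalar 0 = 0"
  by transfer (simp add: free_scalar_def weyl_rel_def weyl_ideal.zero)

lemma weyl_scalar_1 [simp]: "weyl_scalar 1 = 1"
  by transfer (simp add: free_scalar_def weyl_rel_def weyl_ideal.zero)

lemma weyl_scalar_add: "weyl_scalar (a + b) = weyl_scalar a + weyl_scalar b"
  by transfer (simp add: free_scalar_def weyl_rel_def weyl_ideal.zero single_add)

lemma weyl_scalar_mult: "weyl_scalar (a * b) = weyl_scalar a * weyl_scalar b"
  by transfer (simp add: free_scalar_def weyl_rel_def weyl_ideal.zero mult_single)

lemma weyl_scalar_commute: "weyl_scalar c * a = a * weyl_scalar c"
proof transfer
  fix c :: 'a and a :: "'a free_alg"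
  have "free_scalar c * a = a * free_scalar c"
    by (induction a rule: free_alg_induct)
      (auto simp: free_scalar_def mult_single mult.commute distrib_left distrib_right)
  thus "weyl_rel (free_scalar c * a) (a * free_scalar c)"
    by (simp add: weyl_rel_def weyl_ideal.zero)
qed

lemma weyl_scalar_left_commute: "a * (weyl_scalar c * b) = weyl_scalar c * (a * b)"
  by (metis mult.assoc weyl_scalar_commute)

text \<open>Allows two polynomials of different degree to be expanded over a common range of
  exponents.\<close>

lemma weyl_polyH_superset:
  assumes "Polynomial.degree p \<le> n"
  shows "weyl_polyH p = (\<Sum>k\<le>n. weyl_scalar (Polynomial.coeff p k) * weyl_H ^ k)"
  unfolding weyl_polyH_def using assms
  by (intro sum.mono_neutral_left) (auto simp: coeff_eq_0)

lemma weyl_polyH_add: "weyl_polyH (p + q) = weyl_polyH p + weyl_polyH q"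
proof -
  define n where "n = max (Polynomial.degree p) (Polynomial.degree q)"
  have "Polynomial.degree p \<le> n" "Polynomial.degree q \<le> n" "Polynomial.degree (p + q) \<le> n"
    by (auto simp: n_def degree_add_le)
  thus ?thesis
    by (simp add: weyl_polyH_superset weyl_scalar_add distrib_right sum.distrib)
qed

lemma weyl_polyH_smult: "weyl_polyH (smult c p) = weyl_scalar c * weyl_polyH p"
  by (subst (1 2) weyl_polyH_superset[of _ "Polynomial.degree p"])
    (auto simp: weyl_scalar_mult sum_distrib_left mult.assoc degree_smult_le)

lemma weyl_polyH_const [simp]: "weyl_polyH [:c:] = weyl_scalar c"
  by (simp add: weyl_polyH_def)

lemma weyl_polyH_0 [simp]: "weyl_polyH 0 = 0"
  by (simp add: weyl_polyH_def)

lemma weyl_polyH_1 [simp]: "weyl_polyH 1 = 1"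
  using weyl_polyH_const[of 1] by (simp add: one_pCons)

lemma weyl_polyH_diff: "weyl_polyH (p - q) = weyl_polyH p - weyl_polyH q"
  using weyl_polyH_add[of "p - q" q] by simp

lemma weyl_polyH_pCons: "weyl_polyH (pCons a p) = weyl_scalar a + weyl_polyH p * weyl_H"
proof -
  have "weyl_polyH (pCons a p) =
      (\<Sum>k\<le>Suc (Polynomial.degree p). weyl_scalar (Polynomial.coeff (pCons a p) k) * weyl_H ^ k)"
    by (intro weyl_polyH_superset) (simp add: degree_pCons_le)
  also have "\<dots> = weyl_scalar a + weyl_polyH p * weyl_H"
    by (simp add: sum.atMost_Suc_shift weyl_polyH_def sum_distrib_right mult.assoc
        flip: power_Suc2 del: power_Suc sum.atMost_Suc)
  finally show ?thesis .
qed

lemma weyl_polyH_H: "weyl_polyH [:0, 1:] = weyl_H"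
  by (simp add: weyl_polyH_pCons)

lemma weyl_polyH_mult: "weyl_polyH (p * q) = weyl_polyH p * weyl_polyH q"
proof (induction q)
  case (pCons a q)
  have "weyl_polyH (p * pCons a q) = weyl_polyH (smult a p) + weyl_polyH (pCons 0 (p * q))"
    by (simp add: mult_pCons_right weyl_polyH_add)
  thus ?case
    by (simp add: pCons.IH weyl_polyH_smult weyl_polyH_pCons distrib_left mult.assoc
        weyl_scalar_commute)
qed simp

text \<open>The automorphism \<open>H \<mapsto> H - j\<close> of \<open>K[H]\<close> by which \<^term>\<open>weyl_v j\<close> skew-commutes.\<close>

definition shiftp :: "int \<Rightarrow> 'k::field poly \<Rightarrow> 'k poly" where
  "shiftp j p = pcompose p [:- of_int j, 1:]"

lemma shiftp_0 [simp]: "shiftp j 0 = 0"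
  by (simp add: shiftp_def)

lemma shiftp_const [simp]: "shiftp j [:c:] = [:c:]"
  by (simp add: shiftp_def)

lemma shiftp_zero_left [simp]: "shiftp 0 p = p"
  by (simp add: shiftp_def)

lemma shiftp_shiftp: "shiftp i (shiftp j p) = shiftp (i + j) p"
  by (simp add: shiftp_def pcompose_pCons algebra_simps flip: pcompose_assoc)

lemma shiftp_pCons: "shiftp j (pCons a p) = [:a:] + shiftp j p * [:- of_int j, 1:]"
  by (simp add: shiftp_def pcompose_pCons mult.commute)

text \<open>Skew commutation with \<open>weyl_H\<close> alone suffices: both sides follow the same
  Horner recursion in \<open>p\<close>.\<close>

lemma skew_commuteI:
  assumes "v * weyl_H = weyl_polyH [:- of_int j, 1:] * v"
  shows "v * weyl_polyH p = weyl_polyH (shiftp j p) * v"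
proof (induction p)
  case (pCons a p)
  have "v * weyl_polyH (pCons a p) = weyl_scalar a * v + (v * weyl_polyH p) * weyl_H"
    by (simp add: weyl_polyH_pCons distrib_left mult.assoc weyl_scalar_commute)
  also have "(v * weyl_polyH p) * weyl_H = weyl_polyH (shiftp j p * [:- of_int j, 1:]) * v"
    unfolding pCons.IH weyl_polyH_mult mult.assoc assms ..
  finally show ?case
    by (simp only: shiftp_pCons weyl_polyH_add weyl_polyH_const distrib_right)
qed simp

lemma weyl_YX: "weyl_Y * weyl_X = weyl_polyH [:0, 1:]"
  by (simp only: weyl_polyH_H weyl_H_def)

lemma weyl_XY: "weyl_X * weyl_Y = weyl_polyH [:-1, 1:]"
proof -
  have "weyl_polyH [:-1, 1:] = (weyl_polyH ([:0, 1:] - 1) :: 'a weyl)"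
    by (simp add: one_pCons)
  also have "\<dots> = weyl_X * weyl_Y"
    using weyl_commutation by (simp add: weyl_polyH_diff weyl_polyH_H weyl_H_def algebra_simps)
  finally show ?thesis ..
qed

lemma weyl_X_polyH: "weyl_X * weyl_polyH p = weyl_polyH (shiftp 1 p) * weyl_X"
  by (rule skew_commuteI) (simp add: weyl_H_def flip: weyl_XY mult.assoc)

lemma weyl_Y_polyH: "weyl_Y * weyl_polyH p = weyl_polyH (shiftp (-1) p) * weyl_Y"
proof (rule skew_commuteI)
  let ?X = "weyl_X :: 'a weyl" and ?Y = "weyl_Y :: 'a weyl"
  \<comment> \<open>Expanding the inner \<open>?Y * ?X\<close> in Y(YX) gives YH = (H + 1)Y, the
    shift by -1.\<close>
  have YX: "?Y * ?X = 1 + ?X * ?Y"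
    using weyl_commutation[where ?'a = 'a] by (simp add: diff_eq_eq)
  have "?Y * (?Y * ?X) = ?Y * (1 + ?X * ?Y)"
    by (simp only: YX)
  also have "\<dots> = ?Y + (?Y * ?X) * ?Y"
    by (simp add: distrib_left mult.assoc)
  finally have "?Y * (?Y * ?X) = ?Y + (?Y * ?X) * ?Y" .
  moreover have "weyl_polyH [:1, 1:] = 1 + ?Y * ?X"
    by (simp add: weyl_polyH_pCons weyl_H_def)
  ultimately show "?Y * weyl_H = weyl_polyH [:- of_int (- 1), 1:] * ?Y"
    by (simp add: weyl_H_def distrib_right)
qed

section \<open>Skew commutation of \<open>weyl_v j\<close> with K[H]\<close>

lemma weyl_v_0 [simp]: "weyl_v 0 = 1"
  by (simp add: weyl_v_def)

lemma weyl_v_1 [simp]: "weyl_v 1 = weyl_X"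
  by (simp add: weyl_v_def)

lemma weyl_v_of_nat: "weyl_v (int n) = weyl_X ^ n"
  by (simp add: weyl_v_def)

lemma weyl_v_minus_of_nat: "weyl_v (- int n) = weyl_Y ^ n"
  by (cases "n = 0") (simp_all add: weyl_v_def)

lemma weyl_v_power: "weyl_v i ^ n = weyl_v (int n * i)"
proof (cases i rule: int_cases2)
  case (nonneg k)
  thus ?thesis by (simp add: weyl_v_of_nat mult.commute flip: power_mult of_nat_mult)
next
  case (nonpos k)
  thus ?thesis
    using weyl_v_minus_of_nat[of "k * n", where ?'a = 'a]
    by (simp add: weyl_v_minus_of_nat power_mult mult.commute[of "int n"])
qed

lemma power_skew_commute:
  assumes "\<And>p. v * weyl_polyH p = weyl_polyH (shiftp j p) * v"
  shows "v ^ n * weyl_polyH p = weyl_polyH (shiftp (int n * j) p) * v ^ n"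
proof (induction n arbitrary: p)
  case (Suc n)
  have "v ^ Suc n * weyl_polyH p = v ^ n * (v * weyl_polyH p)"
    by (simp only: power_Suc2 mult.assoc)
  also have "\<dots> = weyl_polyH (shiftp (int n * j) (shiftp j p)) * v ^ n * v"
    by (simp only: assms Suc.IH flip: mult.assoc)
  finally show ?case by (simp only: shiftp_shiftp mult.assoc power_Suc2) (simp add: algebra_simps)
qed simp

lemma weyl_v_polyH: "weyl_v j * weyl_polyH p = weyl_polyH (shiftp j p) * weyl_v j"
proof (cases j rule: int_cases2)
  case (nonneg n)
  thus ?thesis using power_skew_commute[OF weyl_X_polyH, of n p] by (simp add: weyl_v_of_nat)
next
  case (nonpos n)
  thus ?thesis using power_skew_commute[OF weyl_Y_polyH, of n p] by (simp add: weyl_v_minus_of_nat)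
qed

lemma polyH_v_mult_polyH_v:
  "weyl_polyH p * weyl_v i * (weyl_polyH q * weyl_v j) =
     weyl_polyH (p * shiftp i q) * (weyl_v i * weyl_v j)"
  by (metis (no_types, lifting) mult.assoc weyl_polyH_mult weyl_v_polyH)

section \<open>The grading\<close>

text \<open>For \<open>j \<ge> 0\<close> the factor is 1; for \<open>j < 0\<close> one Y is absorbed
  through XY = H - 1. Only the existence of \<open>g\<close> is recorded, which is enough to know
  that degrees add.\<close>

lemma weyl_X_v: "\<exists>g. weyl_X * weyl_v j = weyl_polyH g * weyl_v (j + 1)"
proof (cases "j \<ge> 0")
  case True
  then obtain n where "j = int n" by (metis nonneg_int_cases)
  hence "weyl_X * weyl_v j = weyl_polyH 1 * (weyl_v (j + 1) :: 'a weyl)"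
    using weyl_v_of_nat[of "Suc n", where ?'a='a] by (simp add: weyl_v_of_nat add.commute)
  thus ?thesis ..
next
  case False
  define n where "n = nat (- j - 1)"
  have j: "j = - int (Suc n)" "j + 1 = - int n" using False by (auto simp: n_def)
  have "weyl_X * weyl_v (- int (Suc n)) = weyl_polyH [:-1, 1:] * (weyl_v (- int n) :: 'a weyl)"
    unfolding weyl_v_minus_of_nat power_Suc mult.assoc[symmetric] weyl_XY ..
  thus ?thesis by (metis j)
qed

lemma weyl_Y_v: "\<exists>g. weyl_Y * weyl_v j = weyl_polyH g * weyl_v (j - 1)"
proof (cases "j \<le> 0")
  case True
  define n where "n = nat (- j)"
  have j: "j = - int n" "j - 1 = - int (Suc n)" using True by (auto simp: n_def)
  have "weyl_Y * weyl_v (- int n) = weyl_polyH 1 * (weyl_v (- int (Suc n)) :: 'a weyl)"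
    unfolding weyl_v_minus_of_nat by simp
  thus ?thesis by (metis j)
next
  case False
  define n where "n = nat (j - 1)"
  have j: "j = int (Suc n)" "j - 1 = int n" using False by (auto simp: n_def)
  have "weyl_Y * weyl_v (int (Suc n)) = weyl_polyH [:0, 1:] * (weyl_v (int n) :: 'a weyl)"
    unfolding weyl_v_of_nat power_Suc mult.assoc[symmetric] weyl_YX ..
  thus ?thesis by (metis j)
qed

text \<open>Common induction for X (\<open>s = 1\<close>) and Y (\<open>s = -1\<close>): the
  polynomial already produced is moved past one more \<open>x\<close> at the price of a
  shift.\<close>

lemma power_mult_weyl_v:
  assumes "\<And>j. \<exists>g. x * weyl_v j = weyl_polyH g * weyl_v (j + s)"
    and "\<And>p. x * weyl_polyH p = weyl_polyH (shiftp s p) * x"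
  shows "\<exists>g. x ^ n * weyl_v j = weyl_polyH g * weyl_v (j + int n * s)"
proof (induction n)
  case 0
  show ?case by (rule exI[of _ 1]) simp
next
  case (Suc n)
  then obtain g h where g: "x ^ n * weyl_v j = weyl_polyH g * weyl_v (j + int n * s)"
    and h: "x * weyl_v (j + int n * s) = weyl_polyH h * weyl_v (j + int n * s + s)"
    using assms(1) by blast
  have "x ^ Suc n * weyl_v j = weyl_polyH (shiftp s g) * x * weyl_v (j + int n * s)"
    by (simp add: mult.assoc g) (simp add: assms(2) flip: mult.assoc)
  also have "\<dots> = weyl_polyH (shiftp s g * h) * weyl_v (j + int (Suc n) * s)"
    by (simp add: mult.assoc h weyl_polyH_mult distrib_right add_ac)
  finally show ?case ..
qed

lemma weyl_v_mult: "\<exists>g. weyl_v i * weyl_v j = weyl_polyH g * weyl_v (i + j)"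
proof (cases i rule: int_cases2)
  case (nonneg n)
  show ?thesis
    using power_mult_weyl_v[of weyl_X 1 n j, OF weyl_X_v weyl_X_polyH] nonneg
    by (simp add: weyl_v_of_nat add.commute)
next
  case (nonpos n)
  show ?thesis
    using power_mult_weyl_v[of weyl_Y "-1" n j, simplified, OF weyl_Y_v, simplified, OF weyl_Y_polyH] nonpos
    by (simp add: weyl_v_minus_of_nat)
qed


text \<open>A word is built by prepending letters, so left multiplication by the two generators is
  enough.\<close>

lemma weyl_induct [case_names scalar add X Y]:
  fixes a :: "'k::field weyl"
  assumes scalar: "\<And>c. P (weyl_scalar c)"
    and add: "\<And>a b. P a \<Longrightarrow> P b \<Longrightarrow> P (a + b)"
    and X: "\<And>a. P a \<Longrightarrow> P (weyl_X * a)"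
    and Y: "\<And>a. P a \<Longrightarrow> P (weyl_Y * a)"
  shows "P a"
proof (induction a rule: weyl.abs_induct)
  fix f :: "'k free_alg"
  show "P (abs_weyl f)"
  proof (induction f rule: free_alg_induct)
    case (single w c)
    have "P (abs_weyl (Poly_Mapping.single (Word xs) c))" for xs
    proof (induction xs)
      case Nil
      show ?case using scalar[of c]
        by (simp add: weyl_scalar.abs_eq free_scalar_def zero_word_def)
    next
      case (Cons g xs)
      have "Poly_Mapping.single (Word (g # xs)) c = free_gen g * Poly_Mapping.single (Word xs) c"
        by (simp add: free_gen_def mult_single plus_word_def)
      hence "abs_weyl (Poly_Mapping.single (Word (g # xs)) c) =
          abs_weyl (free_gen g) * abs_weyl (Poly_Mapping.single (Word xs) c)"
        by (simp add: times_weyl.abs_eq)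
      with X Y Cons show ?case
        by (cases g) (auto simp: weyl_X.abs_eq weyl_Y.abs_eq)
    qed
    from this[of "letters w"] show ?case by simp
  next
    case (add f g)
    thus ?case using assms(2) by (simp flip: plus_weyl.abs_eq)
  qed
qed

text \<open>Meaningful for finite support only: over an infinite support the sum is 0 by convention,
  hence the finiteness assumptions below.\<close>

definition graded_sum :: "(int \<Rightarrow> 'k::field poly) \<Rightarrow> 'k weyl" where
  "graded_sum p = (\<Sum>j | p j \<noteq> 0. weyl_polyH (p j) * weyl_v j)"

lemma graded_sum_superset:
  assumes "finite A" "{j. p j \<noteq> 0} \<subseteq> A"
  shows "graded_sum p = (\<Sum>j\<in>A. weyl_polyH (p j) * weyl_v j)"
  unfolding graded_sum_def using assms by (intro sum.mono_neutral_left) auto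

lemma
  assumes "finite {j. p j \<noteq> 0}" "finite {j. q j \<noteq> 0}"
  shows graded_sum_add: "graded_sum (\<lambda>j. p j + q j) = graded_sum p + graded_sum q"
    and graded_sum_diff: "graded_sum (\<lambda>j. p j - q j) = graded_sum p - graded_sum q"
proof -
  \<comment> \<open>Cancellation may shrink the support of the sum or difference, so everything is
    summed over the union of the two supports.\<close>
  have *: "graded_sum r = (\<Sum>j\<in>{j. p j \<noteq> 0} \<union> {j. q j \<noteq> 0}. weyl_polyH (r j) * weyl_v j)"
    if "\<And>j. p j = 0 \<Longrightarrow> q j = 0 \<Longrightarrow> r j = 0" for r
    using assms that by (intro graded_sum_superset) auto
  show "graded_sum (\<lambda>j. p j + q j) = graded_sum p + graded_sum q"
    by (subst (1 2 3) *) (auto simp: weyl_polyH_add distrib_right sum.distrib)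
  show "graded_sum (\<lambda>j. p j - q j) = graded_sum p - graded_sum q"
    by (subst (1 2 3) *) (auto simp: weyl_polyH_diff left_diff_distrib sum_subtractf)
qed

lemma graded_sum_homogeneous:
  "graded_sum (\<lambda>k. if k = j then p else 0) = weyl_polyH p * weyl_v j"
  by (subst graded_sum_superset[of "{j}"]) auto

text \<open>The set \<open>G\<close> of finite graded sums contains the scalars and is closed under
  addition and left multiplication by X and Y, so \<open>weyl_induct\<close> applies.\<close>

lemma graded_sum_exists: "\<exists>p. finite {j. p j \<noteq> 0} \<and> a = graded_sum p"
proof -
  define G :: "'a weyl set" where "G = {graded_sum p | p. finite {j. p j \<noteq> 0}}"
  have G_homogeneous: "weyl_polyH p * weyl_v j \<in> G" for p j
    unfolding G_def
    by (auto intro!: exI[of _ "\<lambda>k. if k = j then p else 0"] simp: graded_sum_homogeneous)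
  have G_add: "a + b \<in> G" if ab: "a \<in> G" "b \<in> G" for a b
  proof -
    obtain p q where pq: "finite {j. p j \<noteq> 0}" "finite {j. q j \<noteq> 0}"
      and eq: "a = graded_sum p" "b = graded_sum q"
      using ab by (auto simp: G_def)
    have "{j. p j + q j \<noteq> 0} \<subseteq> {j. p j \<noteq> 0} \<union> {j. q j \<noteq> 0}" by auto
    hence "finite {j. p j + q j \<noteq> 0}" using pq finite_subset by blast
    thus ?thesis unfolding G_def eq graded_sum_add[OF pq, symmetric] by blast
  qed
  have G_0: "0 \<in> G" using G_homogeneous[of 0 0] by simp
  have G_sum: "sum f A \<in> G" if "\<And>j. j \<in> A \<Longrightarrow> f j \<in> G" for f and A :: "int set"
    using that by (induction A rule: infinite_finite_induct) (auto intro: G_0 G_add)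
  have G_mult: "x * a \<in> G"
    if "a \<in> G" and x: "\<And>p j. x * (weyl_polyH p * weyl_v j) \<in> G" for x a
  proof -
    obtain p where "a = graded_sum p" using \<open>a \<in> G\<close> by (auto simp: G_def)
    thus ?thesis by (auto simp: graded_sum_def sum_distrib_left intro: G_sum x)
  qed
  have "a \<in> G"
  proof (induction a rule: weyl_induct)
    case (scalar c)
    show ?case using G_homogeneous[of "[:c:]" 0] by simp
  next
    case (X a)
    thus ?case
    proof (rule G_mult)
      fix p :: "'a poly" and j
      obtain g :: "'a poly" where g: "weyl_X * weyl_v j = weyl_polyH g * weyl_v (j + 1)"
        using weyl_X_v by blast
      have "weyl_X * (weyl_polyH p * weyl_v j) = weyl_polyH (shiftp 1 p) * (weyl_X * weyl_v j)"
        by (simp only: weyl_X_polyH flip: mult.assoc)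
      also have "\<dots> = weyl_polyH (shiftp 1 p * g) * weyl_v (j + 1)"
        by (simp only: g weyl_polyH_mult mult.assoc)
      finally show "weyl_X * (weyl_polyH p * weyl_v j) \<in> G" by (simp add: G_homogeneous)
    qed
  next
    case (Y a)
    thus ?case
    proof (rule G_mult)
      fix p :: "'a poly" and j
      obtain g :: "'a poly" where g: "weyl_Y * weyl_v j = weyl_polyH g * weyl_v (j - 1)"
        using weyl_Y_v by blast
      have "weyl_Y * (weyl_polyH p * weyl_v j) = weyl_polyH (shiftp (-1) p) * (weyl_Y * weyl_v j)"
        by (simp only: weyl_Y_polyH flip: mult.assoc)
      also have "\<dots> = weyl_polyH (shiftp (-1) p * g) * weyl_v (j - 1)"
        by (simp only: g weyl_polyH_mult mult.assoc)
      finally show "weyl_Y * (weyl_polyH p * weyl_v j) \<in> G" by (simp add: G_homogeneous)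
    qed
  qed (rule G_add)
  thus ?thesis by (auto simp: G_def)
qed

text \<open>Reduces additive identities to homogeneous elements.\<close>

lemma homogeneous_induct [case_names homogeneous add]:
  assumes homogeneous: "\<And>p j. P (weyl_polyH p * weyl_v j)"
    and add: "\<And>a b. P a \<Longrightarrow> P b \<Longrightarrow> P (a + b)"
  shows "P a"
proof -
  have 0: "P 0" using homogeneous[of 0 0] by simp
  have "P (\<Sum>j\<in>A. weyl_polyH (p j) * weyl_v j)" for p and A :: "int set"
    by (induction A rule: infinite_finite_induct) (auto intro: 0 homogeneous add)
  thus ?thesis using graded_sum_exists[of a] by (auto simp: graded_sum_def)
qed

text \<open>
  The degrees are independent because \<open>A\<^sub>1\<close> acts on \<open>K[t]\<close> with \<open>X\<close> as multiplication by \<open>t\<close> and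
  \<open>Y\<close> as differentiation: then \<open>H t\<^sup>n = (n + 1) t\<^sup>n\<close>, and \<open>v\<^sub>j\<close> shifts the degree of \<open>t\<^sup>n\<close> by \<open>j\<close>.
\<close>

lift_definition weyl_act :: "'k::field weyl \<Rightarrow> 'k poly \<Rightarrow> 'k poly" is free_act
proof -
  fix f g :: "'k free_alg"
  assume "weyl_rel f g"
  hence "free_act (f - g) p = 0" for p by (simp add: weyl_rel_def free_act_ideal)
  thus "free_act f = free_act g" by (simp add: free_act_minus fun_eq_iff)
qed

lemma weyl_act_0 [simp]: "weyl_act 0 p = 0"
  by transfer simp

lemma weyl_act_1 [simp]: "weyl_act 1 p = p"
  by transfer simp

lemma weyl_act_add: "weyl_act (a + b) p = weyl_act a p + weyl_act b p"
  by transfer (rule free_act_plus)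

lemma weyl_act_sum: "weyl_act (\<Sum>j\<in>A. f j) p = (\<Sum>j\<in>A. weyl_act (f j) p)"
  by (induction A rule: infinite_finite_induct) (auto simp: weyl_act_add)

lemma weyl_act_mult: "weyl_act (a * b) p = weyl_act a (weyl_act b p)"
  by transfer (rule free_act_mult)

lemma weyl_act_scalar: "weyl_act (weyl_scalar c) p = smult c p"
  by transfer (simp add: free_scalar_def free_act_single word_act_def letters_zero)

lemma weyl_act_X: "weyl_act weyl_X p = pCons 0 p"
  by transfer (simp add: free_gen_def free_act_single word_act_def)

lemma weyl_act_Y: "weyl_act weyl_Y p = pderiv p"
  by transfer (simp add: free_gen_def free_act_single word_act_def)

lemma weyl_act_H: "weyl_act weyl_H (Polynomial.monom c n) = Polynomial.monom (of_nat (Suc n) * c) n"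
  by (simp add: weyl_H_def weyl_act_mult weyl_act_X weyl_act_Y pderiv_monom flip: monom_Suc)

lemma weyl_act_polyH:
  "weyl_act (weyl_polyH p) (Polynomial.monom c n) = Polynomial.monom (poly p (of_nat (Suc n)) * c) n"
proof (induction p arbitrary: c)
  case (pCons a p)
  show ?case
    by (simp only: weyl_polyH_pCons weyl_act_add weyl_act_mult weyl_act_scalar weyl_act_H pCons.IH)
      (simp add: smult_monom add_monom algebra_simps)
qed simp

text \<open>The bound on \<open>j\<close> ensures that at most \<open>n\<close> derivatives are
  taken, and in characteristic zero these do not kill t^n.\<close>

lemma weyl_act_v:
  fixes n :: nat and j :: int
  assumes "\<bar>j\<bar> \<le> int n"
  shows "\<exists>c. c \<noteq> 0 \<and>
    weyl_act (weyl_v j) (Polynomial.monom (1 :: 'k::field_char_0) n) = Polynomial.monom c (nat (int n + j))"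
proof (cases j rule: int_cases2)
  case (nonneg m)
  have "weyl_act (weyl_X ^ m) (Polynomial.monom (1::'k) n) = Polynomial.monom 1 (n + m)"
    by (induction m) (simp_all add: weyl_act_mult weyl_act_X monom_Suc)
  with nonneg show ?thesis
    by (auto simp: weyl_v_of_nat nat_add_distrib intro!: exI[of _ 1])
next
  case (nonpos m)
  hence "m \<le> n" using assms by simp
  hence "\<exists>c. c \<noteq> 0 \<and> weyl_act (weyl_Y ^ m) (Polynomial.monom (1::'k) n) = Polynomial.monom c (n - m)"
  proof (induction m)
    case 0
    show ?case by (auto intro!: exI[of _ 1])
  next
    case (Suc m)
    then obtain c where c: "c \<noteq> 0"
      "weyl_act (weyl_Y ^ m) (Polynomial.monom (1::'k) n) = Polynomial.monom c (n - m)"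
      by auto
    show ?case using Suc.prems c
      by (intro exI[of _ "of_nat (n - m) * c"]) (auto simp: weyl_act_mult weyl_act_Y pderiv_monom)
  qed
  moreover have "nat (int n + j) = n - m" using nonpos by auto
  ultimately show ?thesis using nonpos by (simp add: weyl_v_minus_of_nat)
qed

text \<open>Applied to t^n for large n, distinct degrees land in distinct powers of t. The
  coefficient of t^(n+j) is a nonzero multiple of the value of \<open>p j\<close> at n + j + 1, so a
  nonzero \<open>p j\<close> would have infinitely many roots.\<close>

lemma graded_sum_eq_0D:
  fixes p :: "int \<Rightarrow> 'k::field_char_0 poly"
  assumes fin: "finite {j. p j \<noteq> 0}" and 0: "graded_sum p = 0"
  shows "p j = 0"
proof (rule ccontr)
  assume j: "p j \<noteq> 0"
  \<comment> \<open>From exponent \<open>N\<close> on, \<open>weyl_act_v\<close> applies to every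
    degree in the support.\<close>
  define N where "N = Max ((\<lambda>j. nat \<bar>j\<bar>) ` {j. p j \<noteq> 0})"
  have N: "\<bar>k\<bar> \<le> int N" if "p k \<noteq> 0" for k
  proof -
    have "nat \<bar>k\<bar> \<le> N" unfolding N_def using fin that by (intro Max_ge) auto
    thus ?thesis by simp
  qed
  have root: "poly (p j) (of_nat (Suc (nat (int (N + m) + j)))) = 0" for m
  proof -
    define n where "n = N + m"
    have n: "\<bar>k\<bar> \<le> int n" if "p k \<noteq> 0" for k using N[OF that] by (simp add: n_def)
    have "\<forall>k. \<exists>c. p k \<noteq> 0 \<longrightarrow> c \<noteq> 0 \<and>
        weyl_act (weyl_v k) (Polynomial.monom (1 :: 'k) n) = Polynomial.monom c (nat (int n + k))"
      using weyl_act_v n by blast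
    then obtain c where c: "\<And>k. p k \<noteq> 0 \<Longrightarrow> c k \<noteq> 0"
      and act: "\<And>k. p k \<noteq> 0 \<Longrightarrow>
        weyl_act (weyl_v k) (Polynomial.monom (1 :: 'k) n) = Polynomial.monom (c k) (nat (int n + k))"
      by metis
    have "0 = Polynomial.coeff (weyl_act (graded_sum p) (Polynomial.monom 1 n)) (nat (int n + j))"
      by (simp add: 0)
    also have "\<dots> = (\<Sum>k | p k \<noteq> 0. Polynomial.coeff
        (Polynomial.monom (poly (p k) (of_nat (Suc (nat (int n + k)))) * c k) (nat (int n + k)))
        (nat (int n + j)))"
      unfolding graded_sum_def weyl_act_sum coeff_sum
      by (intro sum.cong refl) (simp add: weyl_act_mult act weyl_act_polyH)
    also have "\<dots> = (\<Sum>k | p k \<noteq> 0. if k = j then poly (p j) (of_nat (Suc (nat (int n + j)))) * c j else 0)"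
      using n j by (intro sum.cong refl) (force simp: eq_nat_nat_iff dest!: n)
    also have "\<dots> = poly (p j) (of_nat (Suc (nat (int n + j)))) * c j"
      using fin j by simp
    finally show ?thesis using c[OF j] by (simp add: n_def)
  qed
  \<comment> \<open>\<open>N\<close> is at least the absolute value of \<open>j\<close>, so
    \<open>nat\<close> truncates nothing.\<close>
  have "inj (\<lambda>m. of_nat (Suc (nat (int (N + m) + j))) :: 'k)"
    using N[OF j] by (auto simp: inj_def simp del: of_nat_Suc)
  hence "infinite (range (\<lambda>m. of_nat (Suc (nat (int (N + m) + j))) :: 'k))"
    by (rule range_inj_infinite)
  moreover have "range (\<lambda>m. of_nat (Suc (nat (int (N + m) + j)))) \<subseteq> {x. poly (p j) x = 0}"
    using root by auto
  ultimately show False using poly_roots_finite[OF j] finite_subset by blast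
qed


lemma graded_sum_inject:
  fixes p q :: "int \<Rightarrow> 'k::field_char_0 poly"
  assumes "finite {j. p j \<noteq> 0}" "finite {j. q j \<noteq> 0}" "graded_sum p = graded_sum q"
  shows "p = q"
proof
  fix j
  have "{j. p j - q j \<noteq> 0} \<subseteq> {j. p j \<noteq> 0} \<union> {j. q j \<noteq> 0}" by auto
  hence "finite {j. p j - q j \<noteq> 0}" using assms(1,2) finite_subset by blast
  moreover have "graded_sum (\<lambda>j. p j - q j) = 0" using assms by (simp add: graded_sum_diff)
  ultimately have "p j - q j = 0" by (rule graded_sum_eq_0D)
  thus "p j = q j" by simp
qed

text \<open>The choice is unique by \<open>graded_sum_inject\<close>.\<close>

definition weyl_coeff :: "'k::field_char_0 weyl \<Rightarrow> int \<Rightarrow> 'k poly" where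
  "weyl_coeff a = (SOME p. finite {j. p j \<noteq> 0} \<and> a = graded_sum p)"

lemma
  shows finite_weyl_coeff: "finite {j. weyl_coeff a j \<noteq> 0}"
    and graded_sum_weyl_coeff: "graded_sum (weyl_coeff a) = a"
  using someI_ex[OF graded_sum_exists[of a]] by (simp_all flip: weyl_coeff_def)

lemma weyl_coeff_graded_sum: "finite {j. p j \<noteq> 0} \<Longrightarrow> weyl_coeff (graded_sum p) = p"
  by (intro graded_sum_inject finite_weyl_coeff) (simp_all add: graded_sum_weyl_coeff)

lemma weyl_coeff_homogeneous:
  "weyl_coeff (weyl_polyH p * weyl_v j) k = (if k = j then p else 0)"
  by (subst graded_sum_homogeneous[symmetric], subst weyl_coeff_graded_sum) auto

lemma weyl_coeff_add: "weyl_coeff (a + b) j = weyl_coeff a j + weyl_coeff b j"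
proof -
  have "{j. weyl_coeff a j + weyl_coeff b j \<noteq> 0} \<subseteq> {j. weyl_coeff a j \<noteq> 0} \<union> {j. weyl_coeff b j \<noteq> 0}"
    by auto
  hence "finite {j. weyl_coeff a j + weyl_coeff b j \<noteq> 0}"
    using finite_weyl_coeff[of a] finite_weyl_coeff[of b] finite_subset by blast
  from weyl_coeff_graded_sum[OF this] show ?thesis
    by (simp add: graded_sum_add finite_weyl_coeff graded_sum_weyl_coeff)
qed

lemma weyl_coeff_0 [simp]: "weyl_coeff 0 j = 0"
  using weyl_coeff_homogeneous[of 0 j j] by simp

lemma weyl_coeff_eqI: "(\<And>j. weyl_coeff a j = weyl_coeff b j) \<Longrightarrow> a = b"
  by (metis ext graded_sum_weyl_coeff)

lemma weyl_polyH_v_eq_0_iff [simp]: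
  fixes p :: "'k::field_char_0 poly"
  shows "weyl_polyH p * weyl_v j = 0 \<longleftrightarrow> p = 0"
  using weyl_coeff_homogeneous[of p j j] by auto

section \<open>The adjoint action on homogeneous components\<close>

lemma weyl_ad_add: "weyl_ad x (a + b) = weyl_ad x a + weyl_ad x b"
  by (simp add: weyl_ad_def algebra_simps)

lemma weyl_ad_0 [simp]: "weyl_ad x 0 = 0"
  by (simp add: weyl_ad_def)

lemma weyl_ad_mult: "weyl_ad x (a * b) = weyl_ad x a * b + a * weyl_ad x b"
  by (simp add: weyl_ad_def algebra_simps)

lemma weyl_coeff_mult_polyH: "weyl_coeff (weyl_polyH q * a) j = q * weyl_coeff a j"
proof (induction a rule: homogeneous_induct)
  case (homogeneous p k)
  show ?case by (simp add: weyl_coeff_homogeneous flip: mult.assoc weyl_polyH_mult)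
next
  case (add a b)
  thus ?case by (simp add: distrib_left weyl_coeff_add)
qed

text \<open>Thus \<open>weyl_ad (weyl_polyH p)\<close> is diagonal for the grading, acting in each
  degree as a multiplication in the domain K[H].\<close>

lemma weyl_coeff_ad_polyH:
  "weyl_coeff (weyl_ad (weyl_polyH p) a) j = (p - shiftp j p) * weyl_coeff a j"
proof (induction a rule: homogeneous_induct)
  case (homogeneous q k)
  have "weyl_ad (weyl_polyH p) (weyl_polyH q * weyl_v k) = weyl_polyH ((p - shiftp k p) * q) * weyl_v k"
    using polyH_v_mult_polyH_v[of p 0 q k] polyH_v_mult_polyH_v[of q k p 0]
    by (simp add: weyl_ad_def weyl_polyH_diff left_diff_distrib mult.commute[of _ q] right_diff_distrib)
  thus ?case by (simp add: weyl_coeff_homogeneous)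
next
  case (add a b)
  thus ?case by (simp add: weyl_ad_add distrib_left weyl_coeff_add)
qed

text \<open>A commutator with an element of degree \<open>i\<close> shifts degrees by
  \<open>i\<close>, so only the component of degree \<open>j\<close> contributes to degree
  \<open>i + j\<close>.\<close>

lemma weyl_coeff_ad_homogeneous:
  "weyl_coeff (weyl_ad (weyl_polyH p * weyl_v i) a) (i + j) =
     weyl_coeff (weyl_ad (weyl_polyH p * weyl_v i) (weyl_polyH (weyl_coeff a j) * weyl_v j)) (i + j)"
proof (induction a rule: homogeneous_induct)
  case (homogeneous q k)
  obtain g h :: "'a poly" where "weyl_v i * weyl_v k = weyl_polyH g * weyl_v (i + k)"
    and "weyl_v k * weyl_v i = weyl_polyH h * weyl_v (i + k)"
    using weyl_v_mult by (metis add.commute)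
  hence "weyl_ad (weyl_polyH p * weyl_v i) (weyl_polyH q * weyl_v k) =
      weyl_polyH (p * shiftp i q * g - q * shiftp k p * h) * weyl_v (i + k)"
    by (simp add: weyl_ad_def polyH_v_mult_polyH_v)
      (simp add: weyl_polyH_diff left_diff_distrib weyl_polyH_mult mult.assoc)
  thus ?case by (simp add: weyl_coeff_homogeneous)
next
  case (add a b)
  thus ?case by (simp add: weyl_ad_add distrib_right weyl_coeff_add weyl_polyH_add)
qed

text \<open>A nonzero component in degree \<open>i + j\<close> of an eigenvector forces one in
  degree \<open>j\<close>. Descending in steps of \<open>i\<close> would give an infinite
  support.\<close>

lemma weyl_eigenspace_homogeneous:
  fixes a :: "'k::field_char_0 weyl"
  assumes "i \<noteq> 0" "\<mu> \<noteq> 0" and a: "a \<in> weyl_eigenspace (weyl_polyH p * weyl_v i) \<mu>"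
  shows "a = 0"
proof -
  have step: "weyl_coeff a j \<noteq> 0" if "weyl_coeff a (i + j) \<noteq> 0" for j
  proof
    assume 0: "weyl_coeff a j = 0"
    have "[:\<mu>:] * weyl_coeff a (i + j) = weyl_coeff (weyl_ad (weyl_polyH p * weyl_v i) a) (i + j)"
      using a weyl_coeff_mult_polyH[of "[:\<mu>:]" a "i + j"] by (simp add: weyl_eigenspace_def)
    also have "\<dots> = 0" by (subst weyl_coeff_ad_homogeneous) (simp add: 0)
    finally show False using that \<open>\<mu> \<noteq> 0\<close> by simp
  qed
  have "weyl_coeff a j = 0" for j
  proof (rule ccontr)
    assume j: "weyl_coeff a j \<noteq> 0"
    have "weyl_coeff a (j - int n * i) \<noteq> 0" for n
    proof (induction n)
      case (Suc n)
      show ?case using step[of "j - int (Suc n) * i"] Suc by (simp add: algebra_simps)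
    qed (simp add: j)
    hence "range (\<lambda>n. j - int n * i) \<subseteq> {j. weyl_coeff a j \<noteq> 0}" by auto
    moreover have "infinite (range (\<lambda>n. j - int n * i))"
      using \<open>i \<noteq> 0\<close> by (intro range_inj_infinite) (auto simp: inj_def)
    ultimately show False using finite_weyl_coeff[of a] finite_subset by blast
  qed
  thus ?thesis by (intro weyl_coeff_eqI) simp
qed

section \<open>Leading coefficients of commutators\<close>

lemma degree_shiftp [simp]: "Polynomial.degree (shiftp j p) = Polynomial.degree p"
  by (simp add: shiftp_def degree_pcompose)

lemma lead_coeff_shiftp: "Polynomial.coeff (shiftp j p) (Polynomial.degree p) = Polynomial.lead_coeff p"
  using Polynomial.lead_coeff_comp[of "[:- of_int j, 1:]" p] by (simp add: shiftp_def degree_pcompose)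

text \<open>The leading terms of p(H) and p(H - j) cancel, and the binomial expansion supplies the
  next coefficient. For constant \<open>p\<close> the truncated degree is 0 and the formula
  correctly gives 0.\<close>

lemma diff_shiftp:
  fixes p :: "'k::field poly"
  shows "Polynomial.degree (p - shiftp j p) \<le> Polynomial.degree p - 1"
    and "Polynomial.coeff (p - shiftp j p) (Polynomial.degree p - 1) =
      of_int j * of_nat (Polynomial.degree p) * Polynomial.lead_coeff p"
proof -
  have "Polynomial.degree (p - shiftp j p) \<le> Polynomial.degree p - 1 \<and>
    Polynomial.coeff (p - shiftp j p) (Polynomial.degree p - 1) =
      of_int j * of_nat (Polynomial.degree p) * Polynomial.lead_coeff p"
  proof (induction p)
    case (pCons a p)
    let ?n = "Polynomial.degree p" and ?E = "p - shiftp j p"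
    show ?case
    proof (cases "p = 0")
      case False
      \<comment> \<open>This is H p(H) - (H - j) p(H - j) = H (p(H) - p(H - j)) + j p(H -
        j).\<close>
      have E: "pCons a p - shiftp j (pCons a p) = pCons 0 ?E + smult (of_int j) (shiftp j p)"
        by (simp add: shiftp_pCons)
      have "Polynomial.degree (pCons 0 ?E) \<le> ?n"
      \<comment> \<open>At \<open>?n = 0\<close> the truncated bound \<open>?n - 1\<close> is too
        weak, but there \<open>?E\<close> vanishes outright.\<close>
      proof (cases "?n = 0")
        case True
        then obtain c where "p = [:c:]" by (rule degree_eq_zeroE)
        thus ?thesis by simp
      next
        case False
        thus ?thesis using pCons.IH degree_pCons_le[of 0 ?E] by linarith
      qed
      moreover have "Polynomial.degree (smult (of_int j) (shiftp j p)) \<le> ?n"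
        using degree_smult_le[of "of_int j" "shiftp j p"] by simp
      ultimately have "Polynomial.degree (pCons 0 ?E + smult (of_int j) (shiftp j p)) \<le> ?n"
        by (rule degree_add_le)
      moreover have "Polynomial.coeff (pCons 0 ?E + smult (of_int j) (shiftp j p)) ?n =
          of_int j * of_nat (Suc ?n) * Polynomial.lead_coeff p"
        using pCons.IH lead_coeff_shiftp[of j p]
        by (cases ?n) (auto simp: algebra_simps)
      ultimately show ?thesis using False by (simp add: E)
    qed simp
  qed simp
  thus "Polynomial.degree (p - shiftp j p) \<le> Polynomial.degree p - 1"
    and "Polynomial.coeff (p - shiftp j p) (Polynomial.degree p - 1) =
      of_int j * of_nat (Polynomial.degree p) * Polynomial.lead_coeff p" by auto
qed

text \<open>The coefficient computed in \<open>diff_shiftp\<close> is nonzero in characteristic zero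
  and lies above the constant term.\<close>

lemma diff_shiftp_neq_const:
  fixes p :: "'k::field_char_0 poly"
  assumes "j \<noteq> 0" "Polynomial.degree p > 1"
  shows "p - shiftp j p \<noteq> [:c:]"
proof
  assume "p - shiftp j p = [:c:]"
  hence "Polynomial.coeff (p - shiftp j p) (Polynomial.degree p - 1) = 0"
    using assms(2) by (auto simp: coeff_pCons split: nat.split)
  thus False using assms unfolding diff_shiftp(2) by auto
qed

lemma diff_shiftp_neq_0:
  fixes p :: "'k::field_char_0 poly"
  assumes "j \<noteq> 0" "Polynomial.degree p > 0"
  shows "p - shiftp j p \<noteq> 0"
proof
  assume "p - shiftp j p = 0"
  hence "Polynomial.coeff (p - shiftp j p) (Polynomial.degree p - 1) = 0" by simp
  thus False using assms unfolding diff_shiftp(2) by auto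
qed

text \<open>Stated with degree bounds, because a difference \<open>p - shiftp j p\<close> may have
  smaller degree than expected.\<close>

lemma coeff_mult_degree_le:
  fixes p q :: "'k::comm_semiring_0 poly"
  assumes "Polynomial.degree p \<le> m" "Polynomial.degree q \<le> n"
  shows "Polynomial.coeff (p * q) (m + n) = Polynomial.coeff p m * Polynomial.coeff q n"
proof -
  have "Polynomial.coeff (p * q) (m + n) =
      (\<Sum>k\<le>m + n. Polynomial.coeff p k * Polynomial.coeff q (m + n - k))"
    by (simp add: coeff_mult)
  also have "\<dots> = (\<Sum>k\<in>{m}. Polynomial.coeff p k * Polynomial.coeff q (m + n - k))"
  proof (rule sum.mono_neutral_right)
    show "\<forall>k\<in>{..m + n} - {m}. Polynomial.coeff p k * Polynomial.coeff q (m + n - k) = 0"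
    proof
      fix k assume "k \<in> {..m + n} - {m}"
      hence "k > m \<or> m + n - k > n" by auto
      thus "Polynomial.coeff p k * Polynomial.coeff q (m + n - k) = 0"
        using assms by (auto simp: coeff_eq_0)
    qed
  qed auto
  finally show ?thesis by simp
qed

text \<open>These are the coefficients of commutators of homogeneous elements. After rewriting as
  b(a - a(H - j)) - a(b - b(H - i)), the two products contribute \<open>j * (1 + int d)\<close> and
  \<open>i * int e\<close> times the leading coefficients in degree \<open>e + d\<close>;
  \<open>neq\<close> says that they do not cancel.\<close>

lemma skew_commutator_degree:
  fixes a b :: "'k::field_char_0 poly"
  assumes a: "Polynomial.degree a = Suc d"
    and b: "Polynomial.degree b = e" "b \<noteq> 0"
    and neq: "j * (1 + int d) \<noteq> i * int e"
  shows "Polynomial.degree (a * shiftp i b - b * shiftp j a) = e + d"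
    and "a * shiftp i b - b * shiftp j a \<noteq> 0"
proof -
  let ?r = "a * shiftp i b - b * shiftp j a"
  have r: "?r = b * (a - shiftp j a) - a * (b - shiftp i b)"
    by (simp add: algebra_simps)
  have "a \<noteq> 0" using a by auto
  have da: "Polynomial.degree (a - shiftp j a) \<le> d" using diff_shiftp(1)[of a j] a by simp
  have db: "Polynomial.degree (b - shiftp i b) \<le> e - 1" using diff_shiftp(1)[of b i] b by simp
  \<comment> \<open>For \<open>e = 0\<close> the bound \<open>e - 1\<close> truncates to 0 and would
    allow degree \<open>d + 1\<close> in the product, so this case is kept apart.\<close>
  have const: "b - shiftp i b = 0" if "e = 0"
    using that b degree_eq_zeroE[of b] by (metis cancel_comm_monoid_add_class.diff_cancel shiftp_const)
  have "Polynomial.degree (b * (a - shiftp j a)) \<le> e + d"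
    using degree_mult_le[of b "a - shiftp j a"] b da by linarith
  moreover have "Polynomial.degree (a * (b - shiftp i b)) \<le> e + d"
  proof (cases "e = 0")
    case False
    thus ?thesis using degree_mult_le[of a "b - shiftp i b"] a db by linarith
  qed (simp add: const)
  ultimately have le: "Polynomial.degree ?r \<le> e + d"
    unfolding r by (rule degree_diff_le)
  have c1: "Polynomial.coeff (b * (a - shiftp j a)) (e + d) =
      of_int (j * (1 + int d)) * Polynomial.lead_coeff a * Polynomial.lead_coeff b"
    using coeff_mult_degree_le[of b e "a - shiftp j a" d] diff_shiftp(2)[of a j] a b da by simp
  have c2: "Polynomial.coeff (a * (b - shiftp i b)) (e + d) =
      of_int (i * int e) * Polynomial.lead_coeff a * Polynomial.lead_coeff b"
  proof (cases e)
    case (Suc e')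
    thus ?thesis
      using coeff_mult_degree_le[of a "Suc d" "b - shiftp i b" e'] diff_shiftp(2)[of b i] a b db
      by (simp add: add.commute)
  qed (simp add: const)
  have "Polynomial.coeff ?r (e + d) =
      of_int (j * (1 + int d) - i * int e) * Polynomial.lead_coeff a * Polynomial.lead_coeff b"
    unfolding r coeff_diff c1 c2 by (simp only: of_int_diff left_diff_distrib)
  moreover have "\<dots> \<noteq> 0"
    using neq \<open>a \<noteq> 0\<close> \<open>b \<noteq> 0\<close> by (simp only: mult_eq_0_iff of_int_eq_0_iff leading_coeff_0_iff) simp
  ultimately have nz: "Polynomial.coeff ?r (e + d) \<noteq> 0" by simp
  thus "?r \<noteq> 0" by auto
  show "Polynomial.degree ?r = e + d" using le le_degree[OF nz] by simp
qed


section \<open>Extension of scalars\<close>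

lemma weyl_ext_scalar: "weyl_ext (weyl_scalar c) = weyl_scalar (to_ac c)"
  by transfer (simp add: free_scalar_def weyl_rel_def weyl_ideal.zero)

lemma weyl_ext_0 [simp]: "weyl_ext 0 = 0"
  using weyl_ext_scalar[of 0] by simp

lemma weyl_ext_1 [simp]: "weyl_ext 1 = 1"
  using weyl_ext_scalar[of 1] by simp

lemma weyl_ext_add: "weyl_ext (a + b) = weyl_ext a + weyl_ext b"
  by transfer (simp add: map_to_ac_add weyl_rel_def weyl_ideal.zero)

lemma weyl_ext_diff: "weyl_ext (a - b) = weyl_ext a - weyl_ext b"
  by transfer (simp add: map_to_ac_diff weyl_rel_def weyl_ideal.zero)

lemma weyl_ext_mult: "weyl_ext (a * b) = weyl_ext a * weyl_ext b"
  by transfer (simp add: map_to_ac_mult weyl_rel_def weyl_ideal.zero)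

lemma weyl_ext_power: "weyl_ext (a ^ n) = weyl_ext a ^ n"
  by (induction n) (simp_all add: weyl_ext_mult)

lemma weyl_ext_X [simp]: "weyl_ext weyl_X = weyl_X"
  by transfer (simp add: free_gen_def weyl_rel_def weyl_ideal.zero)

lemma weyl_ext_Y [simp]: "weyl_ext weyl_Y = weyl_Y"
  by transfer (simp add: free_gen_def weyl_rel_def weyl_ideal.zero)

lemma weyl_ext_v [simp]: "weyl_ext (weyl_v j) = weyl_v j"
  by (simp add: weyl_v_def weyl_ext_power)

lemma weyl_ext_polyH: "weyl_ext (weyl_polyH p) = weyl_polyH (map_poly to_ac p)"
  by (induction p)
    (simp_all add: weyl_polyH_pCons map_poly_pCons weyl_ext_add weyl_ext_mult weyl_ext_scalar weyl_H_def)

lemma map_poly_to_ac_eq_0_iff [simp]: "map_poly to_ac p = 0 \<longleftrightarrow> p = 0"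
  by (simp add: poly_eq_iff coeff_map_poly)

lemma degree_map_poly_to_ac [simp]: "Polynomial.degree (map_poly to_ac p) = Polynomial.degree p"
  by (intro degree_map_poly) auto

text \<open>Extension of scalars respects the grading; its injectivity follows from that of
  \<open>to_ac\<close>.\<close>

lemma weyl_coeff_ext: "weyl_coeff (weyl_ext a) j = map_poly to_ac (weyl_coeff a j)"
proof (induction a rule: homogeneous_induct)
  case (homogeneous p k)
  show ?case by (simp add: weyl_ext_mult weyl_ext_polyH weyl_coeff_homogeneous)
next
  case (add a b)
  have "map_poly to_ac (p + q) = map_poly to_ac p + map_poly to_ac q" for p q :: "'a poly"
    by (simp add: poly_eq_iff coeff_map_poly)
  with add show ?case by (simp add: weyl_ext_add weyl_coeff_add)
qed

lemma weyl_ext_eq_0_iff [simp]: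
  fixes a :: "'k::field_char_0 weyl"
  shows "weyl_ext a = 0 \<longleftrightarrow> a = 0"
proof
  assume "weyl_ext a = 0"
  hence "map_poly to_ac (weyl_coeff a j) = 0" for j by (simp flip: weyl_coeff_ext)
  thus "a = 0" by (intro weyl_coeff_eqI) simp
qed simp

lemma weyl_ad_ext: "weyl_ad (weyl_ext x) (weyl_ext a) = weyl_ext (weyl_ad x a)"
  by (simp add: weyl_ad_def weyl_ext_diff weyl_ext_mult)

text \<open>If 0 is the only eigenvalue over the closure, the sum of eigenspaces there is the
  centralizer, which descends because \<open>weyl_ext\<close> is injective.\<close>

lemma weyl_D_eq_C:
  fixes x :: "'k::field_char_0 weyl"
  assumes "\<And>\<mu> a. \<mu> \<noteq> 0 \<Longrightarrow> a \<in> weyl_eigenspace (weyl_ext x) \<mu> \<Longrightarrow> a = 0"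
  shows "weyl_D x = weyl_C x"
proof -
  have eigenvalues: "weyl_eigenvalues (weyl_ext x) = {0}"
  proof -
    \<comment> \<open>The unit makes 0 an eigenvalue, so the index set {0} is admissible in
      \<open>weyl_D_ev\<close>.\<close>
    have "1 \<in> weyl_eigenspace (weyl_ext x) 0" by (simp add: weyl_eigenspace_def weyl_ad_def)
    hence "0 \<in> weyl_eigenvalues (weyl_ext x)"
      unfolding weyl_eigenvalues_def using zero_neq_one by (metis (mono_tags, lifting) mem_Collect_eq)
    moreover have "\<mu> = 0" if "\<mu> \<in> weyl_eigenvalues (weyl_ext x)" for \<mu>
      using that assms[of \<mu>] by (auto simp: weyl_eigenvalues_def)
    ultimately show ?thesis by auto
  qed
  have "weyl_D_ev (weyl_ext x) = weyl_C (weyl_ext x)"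
  proof (intro equalityI subsetI)
    fix a assume "a \<in> weyl_D_ev (weyl_ext x)"
    then obtain L f where L: "L \<subseteq> {0}" and a: "a = (\<Sum>\<mu>\<in>L. f \<mu>)"
      and f: "\<forall>\<mu>\<in>L. f \<mu> \<in> weyl_eigenspace (weyl_ext x) \<mu>"
      by (auto simp: weyl_D_ev_def eigenvalues)
    from L consider "L = {}" | "L = {0}" by auto
    thus "a \<in> weyl_C (weyl_ext x)"
      using a f by cases (auto simp: weyl_C_def weyl_eigenspace_def)
  next
    fix a assume "a \<in> weyl_C (weyl_ext x)"
    thus "a \<in> weyl_D_ev (weyl_ext x)"
      unfolding weyl_D_ev_def eigenvalues
      by (auto simp: weyl_C_def weyl_eigenspace_def intro!: exI[of _ "{0}"] exI[of _ "\<lambda>_. a"])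
  qed
  thus ?thesis by (auto simp: weyl_D_def weyl_C_def weyl_ad_ext)
qed

section \<open>Elements of degree zero\<close>

lemma weyl_coeff_funpow_ad_polyH:
  "weyl_coeff ((weyl_ad (weyl_polyH p) ^^ n) a) j = (p - shiftp j p) ^ n * weyl_coeff a j"
  by (induction n) (simp_all add: weyl_coeff_ad_polyH mult.assoc)

text \<open>In each degree the action is multiplication by an element of a domain; if a power of it
  annihilates a component, so does the element itself.\<close>

lemma weyl_N_polyH:
  fixes p :: "'k::field_char_0 poly"
  shows "weyl_N (weyl_polyH p) = weyl_C (weyl_polyH p)"
proof (intro equalityI subsetI)
  fix a assume "a \<in> weyl_N (weyl_polyH p)"
  then obtain n where "(weyl_ad (weyl_polyH p) ^^ (n + 1)) a = 0" by (auto simp: weyl_N_def)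
  hence "(p - shiftp j p) ^ (n + 1) * weyl_coeff a j = 0" for j
    by (metis weyl_coeff_0 weyl_coeff_funpow_ad_polyH)
  hence "(p - shiftp j p) * weyl_coeff a j = 0" for j
    by (metis mult_eq_0_iff power_not_zero)
  thus "a \<in> weyl_C (weyl_polyH p)"
    by (auto simp: weyl_C_def weyl_coeff_ad_polyH intro!: weyl_coeff_eqI)
next
  fix a assume "a \<in> weyl_C (weyl_polyH p)"
  thus "a \<in> weyl_N (weyl_polyH p)" by (auto simp: weyl_C_def weyl_N_def intro!: exI[of _ 0])
qed

lemma weyl_C_polyH_neq_UNIV:
  fixes p :: "'k::field_char_0 poly"
  assumes "Polynomial.degree p > 0"
  shows "weyl_C (weyl_polyH p) \<noteq> UNIV"
proof
  assume "weyl_C (weyl_polyH p) = UNIV"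
  hence "weyl_ad (weyl_polyH p) weyl_X = 0" by (auto simp: weyl_C_def)
  hence "(p - shiftp 1 p) * weyl_coeff weyl_X 1 = 0"
    by (metis weyl_coeff_0 weyl_coeff_ad_polyH)
  moreover have "weyl_coeff weyl_X 1 = (1 :: 'k poly)"
    using weyl_coeff_homogeneous[of "1 :: 'k poly" 1 1] by simp
  ultimately show False using diff_shiftp_neq_0[of 1 p] assms by simp
qed

lemma weyl_D_polyH_nonlinear:
  fixes p :: "'k::field_char_0 poly"
  assumes "Polynomial.degree p > 1"
  shows "weyl_D (weyl_polyH p) = weyl_C (weyl_polyH p)"
proof (rule weyl_D_eq_C)
  fix \<mu> a
  let ?p = "map_poly to_ac p"
  assume \<mu>: "\<mu> \<noteq> 0" and "a \<in> weyl_eigenspace (weyl_ext (weyl_polyH p)) \<mu>"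
  hence "weyl_ad (weyl_polyH ?p) a = weyl_polyH [:\<mu>:] * a"
    by (simp add: weyl_eigenspace_def weyl_ext_polyH)
  hence eq: "(?p - shiftp j ?p) * weyl_coeff a j = [:\<mu>:] * weyl_coeff a j" for j
    by (metis weyl_coeff_ad_polyH weyl_coeff_mult_polyH)
  \<comment> \<open>In degree 0 the difference is 0; in other degrees it is not constant.\<close>
  have neq: "?p - shiftp j ?p \<noteq> [:\<mu>:]" for j
    using diff_shiftp_neq_const[of j ?p \<mu>] assms \<mu> by (cases "j = 0") auto
  have "weyl_coeff a j = 0" for j
    using eq[of j] neq[of j] by (metis mult_right_cancel)
  thus "a = 0" by (intro weyl_coeff_eqI) simp
qed

text \<open>For p = b + cH one has p(H) - p(H - j) = jc, so every homogeneous element of degree j is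
  an eigenvector with eigenvalue jc.\<close>

lemma weyl_D_polyH_linear:
  fixes p :: "'k::field_char_0 poly"
  assumes "Polynomial.degree p = 1"
  shows "weyl_D (weyl_polyH p) = UNIV"
proof -
  obtain b q where q: "p = pCons b q" by (cases p)
  hence "Polynomial.degree q = 0" "q \<noteq> 0" using assms by (auto simp: degree_pCons_eq_if split: if_splits)
  then obtain c where p: "p = [:b, c:]" and c: "c \<noteq> 0"
    unfolding q by (metis degree_eq_zeroE pCons_0_0)
  let ?u = "weyl_ext (weyl_polyH p)" and ?ev = "\<lambda>j. to_ac (of_int j * c)"
  have u: "?u = weyl_polyH [:to_ac b, to_ac c:]"
    by (simp add: p weyl_ext_polyH map_poly_pCons)
  have eigen: "weyl_polyH q * weyl_v j \<in> weyl_eigenspace ?u (?ev j)" for q j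
  proof -
    have "weyl_ad ?u (weyl_polyH q * weyl_v j) = weyl_polyH [:?ev j:] * (weyl_polyH q * weyl_v j)"
      unfolding u
      by (rule weyl_coeff_eqI, unfold weyl_coeff_ad_polyH
          weyl_coeff_mult_polyH[of "[:?ev j:]" "weyl_polyH q * weyl_v j"] weyl_coeff_homogeneous)
        (simp add: shiftp_pCons)
    thus ?thesis by (simp add: weyl_eigenspace_def)
  qed
  \<comment> \<open>In characteristic zero distinct degrees have distinct eigenvalues, so components
    can be indexed by eigenvalue as \<open>weyl_D_ev\<close> asks.\<close>
  have inj: "inj ?ev" using c by (auto simp: inj_def)
  have "weyl_ext a \<in> weyl_D_ev ?u" for a
  proof -
    define q where "q = weyl_coeff (weyl_ext a)"
    \<comment> \<open>Only nonzero components are kept, since they must witness that their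
      eigenvalues occur.\<close>
    define J where "J = {j. q j \<noteq> 0}"
    have "finite J" by (simp add: J_def q_def finite_weyl_coeff)
    define f where "f \<mu> = weyl_polyH (q (inv_into UNIV ?ev \<mu>)) * weyl_v (inv_into UNIV ?ev \<mu>)" for \<mu>
    have f: "f (?ev j) = weyl_polyH (q j) * weyl_v j" for j
      unfolding f_def inv_f_f[OF inj] ..
    have "weyl_ext a = (\<Sum>j\<in>J. weyl_polyH (q j) * weyl_v j)"
      using graded_sum_weyl_coeff[of "weyl_ext a"] by (simp add: graded_sum_def J_def q_def)
    also have "\<dots> = (\<Sum>\<mu>\<in>?ev ` J. f \<mu>)"
      unfolding sum.reindex[OF inj_on_subset[OF inj subset_UNIV]] by (simp only: comp_def f)
    finally have sum: "weyl_ext a = (\<Sum>\<mu>\<in>?ev ` J. f \<mu>)" .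
    have f_eigen: "f \<mu> \<in> weyl_eigenspace ?u \<mu>" and f_nz: "f \<mu> \<noteq> 0" if "\<mu> \<in> ?ev ` J" for \<mu>
      using that eigen by (auto simp only: f) (auto simp: J_def)
    have "?ev ` J \<subseteq> weyl_eigenvalues ?u"
      using f_eigen f_nz unfolding weyl_eigenvalues_def by blast
    with sum f_eigen \<open>finite J\<close> show ?thesis
      unfolding weyl_D_ev_def by blast
  qed
  thus ?thesis by (auto simp: weyl_D_def)
qed

section \<open>Elements of nonzero degree\<close>

lemma weyl_D_homogeneous:
  fixes p :: "'k::field_char_0 poly"
  assumes "i \<noteq> 0"
  shows "weyl_D (weyl_polyH p * weyl_v i) = weyl_C (weyl_polyH p * weyl_v i)"
  by (rule weyl_D_eq_C)
    (auto simp: weyl_ext_mult weyl_ext_polyH intro: weyl_eigenspace_homogeneous[OF assms])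

lemma weyl_ad_homogeneous_H:
  "weyl_ad (weyl_polyH p * weyl_v i) weyl_H = weyl_scalar (- of_int i) * (weyl_polyH p * weyl_v i)"
proof -
  have "weyl_polyH p * weyl_v i * weyl_H = weyl_polyH (p * [:- of_int i, 1:]) * weyl_v i"
    using polyH_v_mult_polyH_v[of p i "[:0, 1:]" 0] by (simp add: weyl_polyH_H shiftp_pCons)
  moreover have "weyl_H * (weyl_polyH p * weyl_v i) = weyl_polyH ([:0, 1:] * p) * weyl_v i"
    by (simp only: weyl_polyH_mult weyl_polyH_H mult.assoc)
  ultimately have "weyl_ad (weyl_polyH p * weyl_v i) weyl_H =
      weyl_polyH (p * [:- of_int i, 1:] - [:0, 1:] * p) * weyl_v i"
    by (simp only: weyl_ad_def weyl_polyH_diff left_diff_distrib)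
  also have "p * [:- of_int i, 1:] - [:0, 1:] * p = smult (- of_int i) p" by simp
  finally show ?thesis by (simp only: weyl_polyH_smult mult.assoc)
qed

text \<open>The witness is \<open>weyl_H\<close>: its commutator with \<open>?u\<close> is a nonzero
  multiple of \<open>?u\<close>, which commutes with \<open>?u\<close>.\<close>

lemma weyl_N_homogeneous_neq_C:
  fixes p :: "'k::field_char_0 poly"
  assumes "i \<noteq> 0" "p \<noteq> 0"
  shows "weyl_N (weyl_polyH p * weyl_v i) \<noteq> weyl_C (weyl_polyH p * weyl_v i)"
proof -
  let ?u = "weyl_polyH p * weyl_v i"
  have "weyl_ad ?u weyl_H = weyl_polyH (smult (- of_int i) p) * weyl_v i"
    by (simp only: weyl_ad_homogeneous_H weyl_polyH_smult mult.assoc)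
  hence "weyl_H \<notin> weyl_C ?u" using assms by (simp add: weyl_C_def)
  moreover have "weyl_ad ?u (weyl_ad ?u weyl_H) = 0"
    unfolding weyl_ad_homogeneous_H by (simp add: weyl_ad_def weyl_scalar_left_commute mult.assoc)
  hence "weyl_H \<in> weyl_N ?u" by (auto simp: weyl_N_def intro!: exI[of _ 1])
  ultimately show ?thesis by blast
qed

section \<open>The ad-nilpotent elements form a subalgebra\<close>

lemma funpow_weyl_ad_0 [simp]: "(weyl_ad x ^^ n) 0 = 0"
  by (induction n) simp_all

lemma funpow_weyl_ad_add: "(weyl_ad x ^^ n) (a + b) = (weyl_ad x ^^ n) a + (weyl_ad x ^^ n) b"
  by (induction n) (simp_all add: weyl_ad_add)

text \<open>By the Leibniz rule each application of \<open>weyl_ad x\<close> spends one of the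
  \<open>m\<close> on \<open>a\<close> or one of the \<open>n\<close> on \<open>b\<close>, so
  induction on \<open>m + n\<close> works; if \<open>m\<close> or \<open>n\<close> is 0, that factor
  is 0.\<close>

lemma funpow_weyl_ad_mult_eq_0:
  assumes "(weyl_ad x ^^ m) a = 0" "(weyl_ad x ^^ n) b = 0"
  shows "(weyl_ad x ^^ (m + n)) (a * b) = 0"
  using assms
proof (induction "m + n" arbitrary: m n a b)
  case 0
  thus ?case by simp
next
  case (Suc k)
  show ?case
  proof (cases "m = 0 \<or> n = 0")
    case True
    thus ?thesis using Suc.prems by auto
  next
    case False
    then obtain m' n' where mn: "m = Suc m'" "n = Suc n'" by (metis not0_implies_Suc)
    have "(weyl_ad x ^^ (m' + n)) (weyl_ad x a * b) = 0"
      by (rule Suc.hyps(1)) (use Suc.prems Suc.hyps(2) mn in \<open>auto simp: funpow_swap1\<close>)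
    moreover have "(weyl_ad x ^^ (m + n')) (a * weyl_ad x b) = 0"
      by (rule Suc.hyps(1)) (use Suc.prems Suc.hyps(2) mn in \<open>auto simp: funpow_swap1\<close>)
    moreover have "(weyl_ad x ^^ (m + n)) (a * b) = (weyl_ad x ^^ (m' + n)) (weyl_ad x (a * b))"
      by (simp only: mn add_Suc funpow_Suc_right comp_apply)
    moreover have "m + n' = m' + n" by (simp add: mn)
    ultimately show ?thesis by (simp add: weyl_ad_mult funpow_weyl_ad_add)
  qed
qed

lemma weyl_N_eq_UNIV:
  assumes X: "weyl_X \<in> weyl_N x" and Y: "weyl_Y \<in> weyl_N x"
  shows "weyl_N x = UNIV"
proof -
  \<comment> \<open>Exponent 0, excluded in \<open>weyl_N\<close>, only adds the case
    \<open>a = 0\<close>, which exponent 1 covers.\<close>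
  have iff: "a \<in> weyl_N x \<longleftrightarrow> (\<exists>n. (weyl_ad x ^^ n) a = 0)" for a
    unfolding weyl_N_def by (auto intro: exI[of _ "Suc _"]) (metis weyl_ad_0)
  have mult: "a * b \<in> weyl_N x" if "a \<in> weyl_N x" "b \<in> weyl_N x" for a b
    using that unfolding iff by (metis funpow_weyl_ad_mult_eq_0)
  have add: "a + b \<in> weyl_N x" if ab: "a \<in> weyl_N x" "b \<in> weyl_N x" for a b
  proof -
    obtain m n where "(weyl_ad x ^^ m) a = 0" "(weyl_ad x ^^ n) b = 0"
      using ab unfolding iff by blast
    hence "(weyl_ad x ^^ (n + m)) a = 0" "(weyl_ad x ^^ (m + n)) b = 0" by (auto simp: funpow_add)
    thus ?thesis unfolding iff by (metis add.commute add.right_neutral funpow_weyl_ad_add)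
  qed
  have "a \<in> weyl_N x" for a
  proof (induction a rule: weyl_induct)
    case (scalar c)
    have "weyl_ad x (weyl_scalar c) = 0" by (simp add: weyl_ad_def weyl_scalar_commute)
    thus ?case unfolding iff by (intro exI[of _ 1]) simp
  qed (auto intro: add mult X Y)
  thus ?thesis by auto
qed

text \<open>Writing z = x^n, [z, y] commutes with x and hence with z, so two applications of
  \<open>weyl_ad\<close> of the scaled power kill \<open>y\<close>.\<close>

lemma mem_weyl_N_power:
  assumes comm: "weyl_ad x y * x ^ n = x ^ n * weyl_ad x y"
  shows "y \<in> weyl_N (weyl_scalar c * x ^ n)"
proof -
  let ?z = "x ^ n" and ?u = "weyl_scalar c * x ^ n"
  \<comment> \<open>Jacobi identity with [x, z] = 0.\<close>
  have "weyl_ad x (weyl_ad z y) = weyl_ad z (weyl_ad x y)" if "z * x = x * z" for z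
  proof -
    have "z * (x * w) = x * (z * w)" for w using that by (metis mult.assoc)
    thus ?thesis by (simp add: weyl_ad_def algebra_simps that)
  qed
  from this[OF power_commutes] have "weyl_ad x (weyl_ad ?z y) = 0"
    using comm by (simp add: weyl_ad_def[of ?z "weyl_ad x y"])
  hence "weyl_ad ?z y * x = x * weyl_ad ?z y" by (simp add: weyl_ad_def[of x])
  hence "weyl_ad ?z y * ?z = ?z * weyl_ad ?z y" by (rule power_commuting_commutes[symmetric, OF sym])
  hence "weyl_ad ?u (weyl_scalar c * weyl_ad ?z y) = 0"
    by (simp only: weyl_ad_def[of ?u] mult.assoc weyl_scalar_left_commute[of ?z]
        weyl_scalar_left_commute[of "weyl_ad ?z y"] diff_self)
  moreover have "weyl_ad ?u y = weyl_scalar c * weyl_ad ?z y"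
    by (simp add: weyl_ad_def weyl_scalar_left_commute mult.assoc right_diff_distrib)
  ultimately show ?thesis by (auto simp: weyl_N_def intro!: exI[of _ 1])
qed

text \<open>The commutators of X and Y with each other are scalars, so
  \<open>mem_weyl_N_power\<close> puts both generators into \<open>weyl_N\<close>.\<close>

lemma weyl_N_scalar_mult_v: "weyl_N (weyl_scalar c * weyl_v i) = UNIV"
proof -
  have "weyl_ad weyl_X weyl_Y = (-1 :: 'a weyl)" "weyl_ad weyl_Y weyl_X = (1 :: 'a weyl)"
    using weyl_commutation[where ?'a = 'a] by (auto simp: weyl_ad_def) (metis minus_diff_eq)
  moreover have "weyl_ad x x = 0" for x :: "'a weyl" by (simp add: weyl_ad_def)
  ultimately have "weyl_X \<in> weyl_N (weyl_scalar c * weyl_X ^ n)" "weyl_Y \<in> weyl_N (weyl_scalar c * weyl_X ^ n)"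
    "weyl_X \<in> weyl_N (weyl_scalar c * weyl_Y ^ n)" "weyl_Y \<in> weyl_N (weyl_scalar c * weyl_Y ^ n)" for n
    by (auto intro!: mem_weyl_N_power)
  thus ?thesis by (auto simp: weyl_v_def intro!: weyl_N_eq_UNIV)
qed

lemma weyl_N_homogeneous_neq_UNIV:
  fixes p :: "'k::field_char_0 poly"
  assumes "i \<noteq> 0" "Polynomial.degree p > 0"
  shows "weyl_N (weyl_polyH p * weyl_v i) \<noteq> UNIV"
proof -
  let ?u = "weyl_polyH p * weyl_v i"
  obtain d where d: "Polynomial.degree p = Suc d" using assms(2) gr0_conv_Suc by blast
  have "\<exists>q. (weyl_ad ?u ^^ n) (weyl_v i) = weyl_polyH q * weyl_v i ^ Suc n \<and>
      q \<noteq> 0 \<and> Polynomial.degree q = n * d" for n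
  proof (induction n)
    case 0
    show ?case by (intro exI[of _ 1]) simp
  next
    case (Suc n)
    then obtain q where q: "(weyl_ad ?u ^^ n) (weyl_v i) = weyl_polyH q * weyl_v (int (Suc n) * i)"
      "q \<noteq> 0" "Polynomial.degree q = n * d"
      by (auto simp only: weyl_v_power)
    let ?r = "p * shiftp i q - q * shiftp (int (Suc n) * i) p"
    \<comment> \<open>The two sides differ by i(n + d + 1), so the leading terms never
      cancel.\<close>
    have neq: "int (Suc n) * i * (1 + int d) \<noteq> i * int (n * d)"
    proof
      assume "int (Suc n) * i * (1 + int d) = i * int (n * d)"
      hence "i * (int n + int d + 1) = 0" by (simp add: algebra_simps)
      with \<open>i \<noteq> 0\<close> show False by simp
    qed
    \<comment> \<open>Powers of the same \<open>weyl_v i\<close> multiply without a polynomial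
      factor, so the degree count stays exact.\<close>
    have "weyl_v i * weyl_v (int (Suc n) * i) = (weyl_v i ^ Suc (Suc n) :: 'k weyl)"
      "weyl_v (int (Suc n) * i) * weyl_v i = (weyl_v i ^ Suc (Suc n) :: 'k weyl)"
      by (simp_all only: weyl_v_power[symmetric] power_Suc power_Suc2 mult.assoc power_commutes)
    hence "(weyl_ad ?u ^^ Suc n) (weyl_v i) = weyl_polyH ?r * weyl_v i ^ Suc (Suc n)"
      by (simp only: funpow.simps comp_apply q(1) weyl_ad_def polyH_v_mult_polyH_v
          weyl_polyH_diff left_diff_distrib)
    moreover note skew_commutator_degree[OF d q(3,2) neq]
    ultimately show ?case by (intro exI[of _ ?r]) (simp add: add.commute)
  qed
  hence "(weyl_ad ?u ^^ n) (weyl_v i) \<noteq> 0" for n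
    by (metis weyl_v_power weyl_polyH_v_eq_0_iff)
  hence "weyl_v i \<notin> weyl_N ?u" unfolding weyl_N_def by blast
  thus ?thesis by auto
qed

theorem theorem5p2:
  fixes \<alpha> :: "'k::field_char_0 poly" and i :: int and u :: "'k weyl"
  assumes "u = weyl_polyH \<alpha> * weyl_v i"
    and "u \<in> weyl_nonscalars"
  shows "u \<in> Delta1 \<union> Delta2 \<union> Delta3 \<union> Delta5
    \<and> (u \<in> Delta1 \<longleftrightarrow> (\<exists>c. c \<noteq> 0 \<and> \<alpha> = [:c:]) \<and> i \<noteq> 0)
    \<and> (u \<in> Delta2 \<longleftrightarrow> (\<nexists>c. \<alpha> = [:c:]) \<and> i \<noteq> 0)
    \<and> (u \<in> Delta3 \<longleftrightarrow> Polynomial.degree \<alpha> = 1 \<and> i = 0)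
    \<and> (u \<in> Delta5 \<longleftrightarrow> Polynomial.degree \<alpha> > 1 \<and> i = 0)"
proof -
  have const_iff: "(\<exists>c. \<alpha> = [:c:]) \<longleftrightarrow> Polynomial.degree \<alpha> = 0"
    by (metis degree_eq_zeroE degree_pCons_0)
  have const_neq_0_iff: "(\<exists>c. c \<noteq> 0 \<and> \<alpha> = [:c:]) \<longleftrightarrow> \<alpha> \<noteq> 0 \<and> Polynomial.degree \<alpha> = 0"
    using const_iff by auto
  note Delta = Delta1_def Delta2_def Delta3_def Delta5_def
  note nonscalar = \<open>u \<in> weyl_nonscalars\<close>
  show ?thesis
  proof (cases "i = 0")
    case True
    hence u: "u = weyl_polyH \<alpha>" using assms(1) by simp
    have "Polynomial.degree \<alpha> \<noteq> 0"
    proof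
      assume "Polynomial.degree \<alpha> = 0"
      then obtain c where "\<alpha> = [:c:]" by (rule degree_eq_zeroE)
      with u nonscalar show False by (simp add: weyl_nonscalars_def)
    qed
    moreover have "weyl_N u = weyl_C u" by (simp add: u weyl_N_polyH)
    \<comment> \<open>Together with N(u) = C(u) this excludes \<open>Delta1\<close> and
      \<open>Delta2\<close> and keeps \<open>Delta3\<close> and \<open>Delta5\<close> apart.\<close>
    moreover have "weyl_C u \<noteq> UNIV" using calculation(1) u weyl_C_polyH_neq_UNIV by blast
    moreover have "weyl_D u = UNIV" if "Polynomial.degree \<alpha> = 1"
      using that by (simp add: u weyl_D_polyH_linear)
    moreover have "weyl_D u = weyl_C u" if "Polynomial.degree \<alpha> > 1"
      using that by (simp add: u weyl_D_polyH_nonlinear)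
    ultimately show ?thesis
      using nonscalar \<open>i = 0\<close> unfolding Delta const_iff const_neq_0_iff
      by (cases "Polynomial.degree \<alpha> = 1") auto
  next
    case False
    have "\<alpha> \<noteq> 0"
    proof
      assume "\<alpha> = 0"
      hence "u = weyl_scalar 0" using assms(1) by simp
      with nonscalar show False by (simp only: weyl_nonscalars_def) blast
    qed
    moreover have "weyl_D u = weyl_C u" using False by (simp add: assms(1) weyl_D_homogeneous)
    \<comment> \<open>Excludes \<open>Delta3\<close> and \<open>Delta5\<close>; whether N(u) is
      everything then decides between \<open>Delta1\<close> and \<open>Delta2\<close>.\<close>
    moreover have "weyl_N u \<noteq> weyl_C u"
      using False calculation(1) weyl_N_homogeneous_neq_C assms(1) by blast
    moreover have "weyl_N u = UNIV" if "Polynomial.degree \<alpha> = 0"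
      using degree_eq_zeroE[OF that] assms(1) by (metis weyl_N_scalar_mult_v weyl_polyH_const)
    moreover have "weyl_N u \<noteq> UNIV" if "Polynomial.degree \<alpha> \<noteq> 0"
      using that False weyl_N_homogeneous_neq_UNIV assms(1) by blast
    ultimately show ?thesis
      using nonscalar False unfolding Delta const_iff const_neq_0_iff
      by (cases "Polynomial.degree \<alpha> = 0") auto
  qed
qed

end
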